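(* Let $\mathcal{A}=\{A,B,R\}$ be three quantum systems with finite-dimensional Hilbert spaces and let $\rho_{ABR}$ be a state. For $q>1$ let $\mathfrak{X}_q^{\Delta_{\{A,B\}}}(\infty)$ be the integrated Euler characteristic of the persistence complex defined by the $q$-deformed total correlation $C_q$, computed in homology relative to the subcomplex $\Delta_{\{A,B\}}$. Then $$\lim_{q\to1}\mathfrak{X}_q^{\Delta_{\{A,B\}}}(\infty)=-I(A:B|R)_\rho\le0,$$ where $I(A:B|R)_\rho=S(AR)+S(BR)-S(R)-S(ABR)$ is the quantum conditional mutual information (von Neumann entropies of the corresponding marginals of $\rho$).
   Context: Tsallis entropy $S_q(J)_\rho=\frac{1}{1-q}(\operatorname{Tr}\rho_J^q-1)$ for nonempty $J\subseteq\mathcal{A}$ with reduced state $\rho_J$; $S(J)=-\operatorname{Tr}\rho_J\log\rho_J$. The $q$-deformed total correlation is $C_q(J)_\rho=\sum_{v\in J}S_q(\{v\})_\rho-S_q(J)_\rho$. The filtration is $G(\varepsilon)=\{\varnothing\ne J\subseteq\mathcal{A}:C_q(J)_\rho\le\varepsilon\}$, $\varepsilon\in\mathbb{R}$. $\Delta_{\{A,B\}}$ denotes the simplicial complex of nonempty subsets of $\{A,B\}$. The relative Betti numbers are $\beta_k^{\mathrm{rel}}(\varepsilon)=\operatorname{rank}H_k(G(\varepsilon),G(\varepsilon)\cap\Delta_{\{A,B\}};\mathbb{Z}_2)$ (simplicial homology relative to the subcomplex), and $\mathfrak{X}_q^{\Delta_{\{A,B\}}}(\infty)=\sum_{k\ge0}(-1)^k\int_0^\infty\beta_k^{\mathrm{rel}}(\varepsilon)d\varepsilon$.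 *)

theory Defs
  imports "HOL-Analysis.Analysis" "Jordan_Normal_Form.Char_Poly"
begin

datatype party = PA | PB | PR

definition parties :: "party list" where
  "parties = [PA, PB, PR]"

text \<open>The Hilbert space of the subsystem J is the tensor product of the spaces of its
parties, taken in the fixed order A, B, R; a basis index is a mixed-radix number.\<close>

definition plist :: "party set \<Rightarrow> party list" where
  "plist J = filter (\<lambda>v. v \<in> J) parties"

definition sdim :: "(party \<Rightarrow> nat) \<Rightarrow> party set \<Rightarrow> nat" where
  "sdim d J = prod_list (map d (plist J))"

fun enc :: "(party \<Rightarrow> nat) \<Rightarrow> party list \<Rightarrow> (party \<Rightarrow> nat) \<Rightarrow> nat" where
  "enc d [] x = 0"
| "enc d (v # vs) x = x v * prod_list (map d vs) + enc d vs x"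

fun dec :: "(party \<Rightarrow> nat) \<Rightarrow> party list \<Rightarrow> nat \<Rightarrow> party \<Rightarrow> nat" where
  "dec d [] i = (\<lambda>_. 0)"
| "dec d (v # vs) i =
     (dec d vs (i mod prod_list (map d vs)))(v := i div prod_list (map d vs))"

definition mtrace :: "complex mat \<Rightarrow> complex" where
  "mtrace M = (\<Sum>i<dim_row M. M $$ (i, i))"

definition psd :: "complex mat \<Rightarrow> bool" where
  "psd M \<longleftrightarrow> (\<forall>v \<in> carrier_vec (dim_col M).
      Im ((M *\<^sub>v v) \<bullet>c v) = 0 \<and> Re ((M *\<^sub>v v) \<bullet>c v) \<ge> 0)"

definition density_matrix :: "(party \<Rightarrow> nat) \<Rightarrow> complex mat \<Rightarrow> bool" where
  "density_matrix d \<rho> \<longleftrightarrow> \<rho> \<in> carrier_mat (sdim d UNIV) (sdim d UNIV)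
      \<and> psd \<rho> \<and> mtrace \<rho> = 1"

definition reduced_state :: "(party \<Rightarrow> nat) \<Rightarrow> complex mat \<Rightarrow> party set \<Rightarrow> complex mat" where
  "reduced_state d \<rho> J = mat (sdim d J) (sdim d J) (\<lambda>(k, l).
     \<Sum>i<sdim d UNIV. \<Sum>j<sdim d UNIV.
       if enc d (plist J) (dec d parties i) = k \<and> enc d (plist J) (dec d parties j) = l
          \<and> (\<forall>v. v \<notin> J \<longrightarrow> dec d parties i v = dec d parties j v)
       then \<rho> $$ (i, j) else 0)"

definition eigs :: "complex mat \<Rightarrow> complex multiset" where
  "eigs M = proots (char_poly M)"

definition tr_fun :: "(real \<Rightarrow> real) \<Rightarrow> complex mat \<Rightarrow> real" where
  "tr_fun f M = sum_mset (image_mset (\<lambda>e. f (Re e)) (eigs M))"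

definition tsallis :: "real \<Rightarrow> (party \<Rightarrow> nat) \<Rightarrow> complex mat \<Rightarrow> party set \<Rightarrow> real" where
  "tsallis q d \<rho> J = (tr_fun (\<lambda>x. x powr q) (reduced_state d \<rho> J) - 1) / (1 - q)"

definition vn_entropy :: "(party \<Rightarrow> nat) \<Rightarrow> complex mat \<Rightarrow> party set \<Rightarrow> real" where
  "vn_entropy d \<rho> J = - tr_fun (\<lambda>x. if x \<le> 0 then 0 else x * ln x) (reduced_state d \<rho> J)"

definition total_corr :: "real \<Rightarrow> (party \<Rightarrow> nat) \<Rightarrow> complex mat \<Rightarrow> party set \<Rightarrow> real" where
  "total_corr q d \<rho> J = (\<Sum>v\<in>J. tsallis q d \<rho> {v}) - tsallis q d \<rho> J"

definition cmi :: "(party \<Rightarrow> nat) \<Rightarrow> complex mat \<Rightarrow> real" where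
  "cmi d \<rho> = vn_entropy d \<rho> {PA, PR} + vn_entropy d \<rho> {PB, PR}
              - vn_entropy d \<rho> {PR} - vn_entropy d \<rho> {PA, PB, PR}"

definition filt :: "real \<Rightarrow> (party \<Rightarrow> nat) \<Rightarrow> complex mat \<Rightarrow> real \<Rightarrow> party set set" where
  "filt q d \<rho> \<epsilon> = {J. J \<noteq> {} \<and> total_corr q d \<rho> J \<le> \<epsilon>}"

definition deltaAB :: "party set set" where
  "deltaAB = {J. J \<noteq> {} \<and> J \<subseteq> {PA, PB}}"

text \<open>Z2-chains are sets of simplices. k-simplices have k+1 vertices.
The relative chain group C_k(K)/C_k(L) is identified with chains supported on K - L.\<close>
definition ksimp :: "'a set set \<Rightarrow> nat \<Rightarrow> 'a set set" where
  "ksimp K k = {\<sigma> \<in> K. card \<sigma> = Suc k}"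

definition rel_bd :: "'a set set \<Rightarrow> 'a set set \<Rightarrow> 'a set set \<Rightarrow> 'a set set" where
  "rel_bd K L c = {\<tau> \<in> K - L. odd (card {\<sigma> \<in> c. \<tau> \<subseteq> \<sigma> \<and> card \<sigma> = Suc (card \<tau>)})}"

definition rel_cycles :: "'a set set \<Rightarrow> 'a set set \<Rightarrow> nat \<Rightarrow> 'a set set set" where
  "rel_cycles K L k = {c. c \<subseteq> ksimp (K - L) k \<and> rel_bd K L c = {}}"

definition rel_boundaries :: "'a set set \<Rightarrow> 'a set set \<Rightarrow> nat \<Rightarrow> 'a set set set" where
  "rel_boundaries K L k = rel_bd K L ` Pow (ksimp (K - L) (Suc k))"

definition symdiff :: "'a set \<Rightarrow> 'a set \<Rightarrow> 'a set" where
  "symdiff a b = (a - b) \<union> (b - a)"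

definition rel_hom :: "'a set set \<Rightarrow> 'a set set \<Rightarrow> nat \<Rightarrow> 'a set set set set" where
  "rel_hom K L k = (\<lambda>c. symdiff c ` rel_boundaries K L k) ` rel_cycles K L k"

text \<open>Rank of the finite Z2-vector space H_k: the n with |H_k| = 2^n.\<close>
definition betti_rel :: "'a set set \<Rightarrow> 'a set set \<Rightarrow> nat \<Rightarrow> nat" where
  "betti_rel K L k = (THE n. card (rel_hom K L k) = 2 ^ n)"

definition euler_int :: "real \<Rightarrow> (party \<Rightarrow> nat) \<Rightarrow> complex mat \<Rightarrow> real" where
  "euler_int q d \<rho> = (\<Sum>k. (-1) ^ k * integral {0..} (\<lambda>\<epsilon>.
      real (betti_rel (filt q d \<rho> \<epsilon>) (filt q d \<rho> \<epsilon> \<inter> deltaAB) k)))"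

end

theory Submission
  imports Defs "HOL-Real_Asymp.Real_Asymp"
    "Jordan_Normal_Form.Schur_Decomposition" "Jordan_Normal_Form.Spectral_Radius"
begin

text \<open>
Relative to \<open>\<Delta>\<^bsub>{A,B}\<^esub>\<close> only the simplices \<open>R\<close>, \<open>AR\<close>, \<open>BR\<close>, \<open>ABR\<close> matter, so the integrated Euler
characteristic is an explicit continuous function of \<open>a = C\<^sub>q(AR)\<close>, \<open>b = C\<^sub>q(BR)\<close>, \<open>c = C\<^sub>q(ABR)\<close>, which
equals \<open>a + b - c\<close> when \<open>0 \<le> a, b \<le> c\<close>. As \<open>q \<rightarrow> 1\<close> Tsallis entropies tend to von Neumann entropies, for
which these inequalities are subadditivity, and the limit of \<open>a + b - c\<close> is \<open>- I(A:B|R)\<close>.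

Strong subadditivity is monotonicity of the relative entropy of \<open>\<rho>\<^bsub>ABR\<^esub>\<close> and \<open>\<rho>\<^bsub>AR\<^esub> \<otimes> 1\<^sub>B\<close> under the
partial trace over \<open>A\<close>. For \<open>t > 0\<close> the quantity \<open>\<langle>\<rho>, (L\<^sub>\<sigma> + t R\<^sub>\<rho>)\<^sup>-\<^sup>1 \<rho>\<rangle>\<close> is the supremum over operators
\<open>X\<close> of \<open>2 Re Tr(X\<^sup>* \<rho>) - Tr(X\<^sup>* \<sigma> X) - t Tr(X \<rho> X\<^sup>*)\<close>. Restricting to \<open>X = 1\<^sub>A \<otimes> X'\<close> gives the same
expression for the partial traces, hence monotonicity for each \<open>t\<close>; integrating over \<open>t\<close> turns
\<open>p\<^sup>2 / (q + t p)\<close> into \<open>p (ln p - ln q)\<close>. Subadditivity is the case of a trivial system \<open>R\<close>.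
\<close>

subsection \<open>Spectral theorem\<close>

text \<open>Orthonormality and completeness are both part of the notion, so unitarity is at hand for
  index sets of different types without comparing cardinalities.\<close>

definition orthonormal_basis :: "'i set \<Rightarrow> 'k set \<Rightarrow> ('k \<Rightarrow> 'i \<Rightarrow> complex) \<Rightarrow> bool" where
  "orthonormal_basis I N u \<longleftrightarrow>
     (\<forall>k\<in>N. \<forall>l\<in>N. (\<Sum>x\<in>I. u k x * cnj (u l x)) = of_bool (k = l)) \<and>
     (\<forall>x\<in>I. \<forall>y\<in>I. (\<Sum>k\<in>N. u k x * cnj (u k y)) = of_bool (x = y))"

text \<open>Operators are functions of two indices instead of matrices: a tensor factorization is
  then a product index set, and tracing out a factor is a plain sum.\<close>

definition diagonalizes ::
  "'i set \<Rightarrow> ('i \<Rightarrow> 'i \<Rightarrow> complex) \<Rightarrow> 'k set \<Rightarrow> ('k \<Rightarrow> 'i \<Rightarrow> complex) \<Rightarrow> ('k \<Rightarrow> real) \<Rightarrow> bool" where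
  "diagonalizes I K N u p \<longleftrightarrow> orthonormal_basis I N u \<and>
     (\<forall>x\<in>I. \<forall>y\<in>I. K x y = (\<Sum>k\<in>N. of_real (p k) * (u k x * cnj (u k y))))"

lemma mult_cnj_self: "z * cnj z = of_real ((cmod z)\<^sup>2)"
  by (simp add: complex_norm_square del: of_real_power)

text \<open>For square matrices a right inverse is also a left inverse, which turns orthonormality
  into completeness.\<close>

lemma orthonormal_basis_square:
  fixes n :: nat and u :: "nat \<Rightarrow> nat \<Rightarrow> complex"
  assumes "\<And>k l. k < n \<Longrightarrow> l < n \<Longrightarrow> (\<Sum>x<n. u k x * cnj (u l x)) = of_bool (k = l)"
  shows "orthonormal_basis {..<n} {..<n} u"
proof -
  define U where "U = mat n n (\<lambda>(k, x). u k x)"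
  define V where "V = mat n n (\<lambda>(x, k). cnj (u k x))"
  have U: "U \<in> carrier_mat n n" and V: "V \<in> carrier_mat n n"
    by (simp_all add: U_def V_def)
  have "U * V = 1\<^sub>m n"
    by (rule eq_matI) (auto simp: U_def V_def scalar_prod_def assms lessThan_atLeast0[symmetric])
  then have VU: "V * U = 1\<^sub>m n" by (rule mat_mult_left_right_inverse[OF U V])
  have "(\<Sum>k<n. u k x * cnj (u k y)) = of_bool (x = y)" if "x < n" "y < n" for x y
  proof -
    have "(V * U) $$ (y, x) = (\<Sum>k<n. u k x * cnj (u k y))"
      using that by (simp add: U_def V_def scalar_prod_def lessThan_atLeast0[symmetric] mult.commute)
    then show ?thesis using that by (auto simp: VU)
  qed
  then show ?thesis using assms by (simp add: orthonormal_basis_def)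
qed

lemma unit_eigenvector_exists:
  fixes K :: "nat \<Rightarrow> nat \<Rightarrow> complex"
  assumes "n > 0"
  obtains v e where "(\<Sum>x<n. v x * cnj (v x)) = 1"
    and "\<And>x. x < n \<Longrightarrow> (\<Sum>y<n. K x y * v y) = e * v x"
proof -
  define A where "A = mat n n (\<lambda>(x, y). K x y)"
  have A: "A \<in> carrier_mat n n" by (simp add: A_def)
  obtain e where "eigenvalue A e"
    using spectrum_non_empty[OF A assms] by (auto simp: spectrum_def)
  then obtain w where w: "w \<in> carrier_vec n" "w \<noteq> 0\<^sub>v n" "A *\<^sub>v w = e \<cdot>\<^sub>v w"
    using A by (auto simp: eigenvalue_def eigenvector_def)
  define s where "s = (\<Sum>x<n. (cmod (vec_index w x))\<^sup>2)"
  have "s > 0"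
  proof -
    obtain i where "i < n" "vec_index w i \<noteq> 0"
      using w(1,2) by (metis carrier_vecD eq_vecI index_zero_vec(1) index_zero_vec(2))
    then show ?thesis unfolding s_def by (intro sum_pos2[of _ i]) auto
  qed
  define v where "v = (\<lambda>x. vec_index w x / of_real (sqrt s))"
  have "(\<Sum>x<n. v x * cnj (v x)) = (\<Sum>x<n. of_real ((cmod (vec_index w x))\<^sup>2 / s))"
    using \<open>s > 0\<close> by (intro sum.cong)
      (auto simp: v_def mult_cnj_self simp flip: of_real_mult)
  also have "\<dots> = of_real ((\<Sum>x<n. (cmod (vec_index w x))\<^sup>2) / s)"
    by (simp add: sum_divide_distrib)
  also have "\<dots> = 1" using \<open>s > 0\<close> by (simp add: s_def)
  finally have 1: "(\<Sum>x<n. v x * cnj (v x)) = 1" .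
  have "(\<Sum>y<n. K x y * v y) = e * v x" if "x < n" for x
  proof -
    have "(\<Sum>y<n. K x y * vec_index w y) = vec_index (A *\<^sub>v w) x"
      using that w(1) by (simp add: A_def scalar_prod_def lessThan_atLeast0[symmetric])
    also have "\<dots> = e * vec_index w x" using that w(1,3) by simp
    finally show ?thesis by (simp add: v_def sum_divide_distrib[symmetric])
  qed
  with 1 show ?thesis by (rule that)
qed

text \<open>Gram-Schmidt applied to a basis starting with \<open>v\<close> keeps \<open>v\<close> in
  front but yields vectors that are only orthogonal; they are divided by their lengths
  afterwards.\<close>

lemma orthonormal_basis_completion:
  fixes v :: "nat \<Rightarrow> complex"
  assumes "n > 0" and v: "(\<Sum>x<n. v x * cnj (v x)) = 1"
  obtains w where "orthonormal_basis {..<n} {..<n} w" "\<And>x. x < n \<Longrightarrow> w 0 x = v x"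
proof -
  define v' where "v' = Matrix.vec n v"
  have v': "v' \<in> carrier_vec n" by (simp add: v'_def)
  have v'0: "v' \<noteq> 0\<^sub>v n"
  proof
    assume "v' = 0\<^sub>v n"
    then have "v x = 0" if "x < n" for x using that by (metis index_vec index_zero_vec(1) v'_def)
    then show False using v by simp
  qed
  interpret cof_vec_space n "TYPE(complex)" .
  define b where "b = basis_completion v'"
  define ws where "ws = gram_schmidt n b"
  note bc = basis_completion[OF v' v'0, folded b_def]
  from gram_schmidt_result[OF bc(2,4,5) refl, folded ws_def]
  have ws: "set ws \<subseteq> carrier_vec n" "corthogonal ws" "length ws = n"
    by (auto simp: bc(6))
  obtain vs where bv: "b = v' # vs" using bc(6,7) assms(1) by (cases b) auto
  have hdws: "hd ws = v'" using gram_schmidt_hd[OF v', of vs, folded bv] by (simp add: ws_def)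
  have ws0: "ws ! 0 = v'" using hdws ws(3) assms(1) by (metis hd_conv_nth length_0_conv less_numeral_extra(3))
  define s where "s = (\<lambda>k. \<Sum>x<n. (cmod (vec_index (ws ! k) x))\<^sup>2)"
  have inner: "(ws ! k) \<bullet>c (ws ! l) = (\<Sum>x<n. vec_index (ws ! k) x * cnj (vec_index (ws ! l) x))"
    if "k < n" "l < n" for k l
  proof -
    have "ws ! k \<in> carrier_vec n" "ws ! l \<in> carrier_vec n" using ws that by auto
    then show ?thesis by (simp add: scalar_prod_def lessThan_atLeast0[symmetric])
  qed
  have s_eq: "(\<Sum>x<n. vec_index (ws ! k) x * cnj (vec_index (ws ! k) x)) = of_real (s k)" for k
    by (simp add: s_def mult_cnj_self)
  have s_pos: "s k > 0" if "k < n" for k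
  proof -
    have "s k \<noteq> 0"
      using corthogonalD[OF ws(2), of k k] that ws(3) inner[of k k] s_eq[of k] by auto
    moreover have "s k \<ge> 0" by (auto simp: s_def intro: sum_nonneg)
    ultimately show ?thesis by simp
  qed
  define w where "w = (\<lambda>k x. vec_index (ws ! k) x / of_real (sqrt (s k)))"
  have "(\<Sum>x<n. w k x * cnj (w l x)) = of_bool (k = l)" if "k < n" "l < n" for k l
  proof -
    have "(\<Sum>x<n. w k x * cnj (w l x))
        = (\<Sum>x<n. vec_index (ws ! k) x * cnj (vec_index (ws ! l) x)) / (of_real (sqrt (s k)) * of_real (sqrt (s l)))"
      by (simp add: w_def sum_divide_distrib)
    also have "\<dots> = of_bool (k = l)"
    proof (cases "k = l")
      case True
      then show ?thesis using s_pos[OF that(1)] by (simp add: s_eq flip: of_real_mult)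
    next
      case False
      then show ?thesis
        using corthogonalD[OF ws(2), of k l] that ws(3) inner[of k l] by auto
    qed
    finally show ?thesis .
  qed
  then have "orthonormal_basis {..<n} {..<n} w" by (rule orthonormal_basis_square)
  moreover have "w 0 x = v x" if "x < n" for x
  proof -
    \<comment> \<open>The given vector already has length 1, so the normalization does not change
      it.\<close>
    have "of_real (s 0) = (1::complex)"
      using v by (simp add: s_eq[symmetric] ws0 v'_def)
    then have "s 0 = 1" by (simp only: of_real_eq_1_iff)
    then show ?thesis using that by (simp add: w_def ws0 v'_def)
  qed
  ultimately show ?thesis by (rule that)
qed

lemma orthonormal_basis_expand:
  assumes "orthonormal_basis I N w" "finite I" "x \<in> I"
  shows "(\<Sum>k\<in>N. w k x * (\<Sum>y\<in>I. cnj (w k y) * f y)) = f x"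
proof -
  have "(\<Sum>k\<in>N. w k x * (\<Sum>y\<in>I. cnj (w k y) * f y))
      = (\<Sum>y\<in>I. (\<Sum>k\<in>N. w k x * cnj (w k y)) * f y)"
    by (simp add: sum_distrib_left sum_distrib_right mult.assoc) (rule sum.swap)
  also have "\<dots> = (\<Sum>y\<in>I. of_bool (x = y) * f y)"
    using assms by (intro sum.cong) (auto simp: orthonormal_basis_def)
  also have "\<dots> = f x"
    using assms by (simp add: of_bool_def if_distrib[of "\<lambda>c. c * _"] cong: if_cong)
  finally show ?thesis .
qed

lemma orthonormal_basis_expand_cnj:
  assumes "orthonormal_basis I N w" "finite I" "x \<in> I"
  shows "(\<Sum>k\<in>N. (\<Sum>y\<in>I. f y * w k y) * cnj (w k x)) = f x"
proof -
  have "cnj (\<Sum>k\<in>N. (\<Sum>y\<in>I. f y * w k y) * cnj (w k x))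
      = (\<Sum>k\<in>N. w k x * (\<Sum>y\<in>I. cnj (w k y) * cnj (f y)))"
    by (simp add: mult.commute)
  also have "\<dots> = cnj (f x)" by (rule orthonormal_basis_expand[OF assms])
  finally show ?thesis by (simp only: complex_cnj_cancel_iff)
qed

text \<open>The completeness relation of \<open>w\<close> is inserted on both sides of
  \<open>K\<close>; the inner double sum is the matrix of \<open>K\<close> in the basis
  \<open>w\<close>.\<close>

lemma kernel_expand:
  assumes w: "orthonormal_basis I N w" "finite I" and "x \<in> I" "y \<in> I"
  shows "K x y = (\<Sum>k\<in>N. \<Sum>l\<in>N. w k x *
           (\<Sum>x'\<in>I. \<Sum>y'\<in>I. cnj (w k x') * K x' y' * w l y') * cnj (w l y))"
proof -
  have "K x y = (\<Sum>k\<in>N. w k x * (\<Sum>x'\<in>I. cnj (w k x') * K x' y))"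
    using orthonormal_basis_expand[OF w assms(3), of "\<lambda>x. K x y"] by simp
  also have "\<dots> = (\<Sum>k\<in>N. w k x * (\<Sum>x'\<in>I. cnj (w k x') *
      (\<Sum>l\<in>N. (\<Sum>y'\<in>I. K x' y' * w l y') * cnj (w l y))))"
    using orthonormal_basis_expand_cnj[OF w assms(4)] by simp
  also have "\<dots> = (\<Sum>k\<in>N. \<Sum>l\<in>N. w k x *
           (\<Sum>x'\<in>I. \<Sum>y'\<in>I. cnj (w k x') * K x' y' * w l y') * cnj (w l y))"
  proof (intro sum.cong refl)
    fix k
    have "(\<Sum>x'\<in>I. cnj (w k x') * (\<Sum>l\<in>N. (\<Sum>y'\<in>I. K x' y' * w l y') * cnj (w l y)))
        = (\<Sum>l\<in>N. (\<Sum>x'\<in>I. \<Sum>y'\<in>I. cnj (w k x') * K x' y' * w l y') * cnj (w l y))"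
      by (subst (2) sum_distrib_right, subst sum.swap)
        (simp add: sum_distrib_left sum_distrib_right mult_ac)
    from arg_cong[OF this, of "\<lambda>c. w k x * c"]
    show "w k x * (\<Sum>x'\<in>I. cnj (w k x') * (\<Sum>l\<in>N. (\<Sum>y'\<in>I. K x' y' * w l y') * cnj (w l y)))
        = (\<Sum>l\<in>N. w k x * (\<Sum>x'\<in>I. \<Sum>y'\<in>I. cnj (w k x') * K x' y' * w l y') * cnj (w l y))"
      by (simp only: sum_distrib_left[where A = N] mult.assoc)
  qed
  finally show ?thesis .
qed

text \<open>Induction on the dimension. In an orthonormal basis that begins with a unit eigenvector,
  the first column of the matrix of \<open>K\<close> is a multiple of the first unit vector. By
  hermiticity so is the first row, and the induction hypothesis diagonalizes the remaining
  block.\<close>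

theorem hermitian_diagonalizes:
  fixes K :: "nat \<Rightarrow> nat \<Rightarrow> complex"
  assumes "\<And>x y. x < n \<Longrightarrow> y < n \<Longrightarrow> K y x = cnj (K x y)"
  shows "\<exists>u p. diagonalizes {..<n} K {..<n} u p"
  using assms
proof (induction n arbitrary: K)
  case 0
  then show ?case by (simp add: diagonalizes_def orthonormal_basis_def)
next
  case (Suc n)
  let ?N = "Suc n"
  obtain v e where v: "(\<Sum>x<?N. v x * cnj (v x)) = 1"
    and ev: "\<And>x. x < ?N \<Longrightarrow> (\<Sum>y<?N. K x y * v y) = e * v x"
    using unit_eigenvector_exists[of ?N K] by blast
  obtain w where w: "orthonormal_basis {..<?N} {..<?N} w" and w0: "\<And>x. x < ?N \<Longrightarrow> w 0 x = v x"
    using orthonormal_basis_completion[OF _ v] by blast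
  have orth: "(\<Sum>x<?N. w k x * cnj (w l x)) = of_bool (k = l)" if "k < ?N" "l < ?N" for k l
    using w that by (simp add: orthonormal_basis_def del: sum.lessThan_Suc)
  define B where "B = (\<lambda>k l. \<Sum>x<?N. \<Sum>y<?N. cnj (w k x) * K x y * w l y)"
  have B0: "B k 0 = e * of_bool (k = 0)" if "k < ?N" for k
  proof -
    have "B k 0 = (\<Sum>x<?N. cnj (w k x) * (\<Sum>y<?N. K x y * v y))"
      unfolding B_def by (intro sum.cong refl) (simp add: w0 sum_distrib_left mult.assoc del: sum.lessThan_Suc)
    also have "\<dots> = (\<Sum>x<?N. cnj (w k x) * (e * w 0 x))"
      by (intro sum.cong refl) (simp add: w0 ev del: sum.lessThan_Suc)
    also have "\<dots> = e * (\<Sum>x<?N. w 0 x * cnj (w k x))"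
      by (simp add: sum_distrib_left mult_ac del: sum.lessThan_Suc)
    also have "\<dots> = e * of_bool (k = 0)" using that by (subst orth) auto
    finally show ?thesis .
  qed
  have Bherm: "B l k = cnj (B k l)" for k l
  proof -
    have "cnj (B k l) = (\<Sum>x<?N. \<Sum>y<?N. cnj (w l y) * K y x * w k x)"
      unfolding B_def cnj_sum complex_cnj_mult complex_cnj_cnj
    proof (intro sum.cong refl)
      fix x y assume "x \<in> {..<?N}" "y \<in> {..<?N}"
      then have "K y x = cnj (K x y)" by (intro Suc.prems) auto
      then show "w k x * cnj (K x y) * cnj (w l y) = cnj (w l y) * K y x * w k x" by simp
    qed
    then show ?thesis unfolding B_def by (subst sum.swap) simp
  qed
  \<comment> \<open>A diagonal entry of a Hermitian matrix equals its conjugate, so the eigenvalue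
    is real.\<close>
  have e_real: "e = of_real (Re e)"
    using Bherm[of 0 0] B0[of 0] by (simp add: complex_eq_iff)
  have B0': "B 0 k = e * of_bool (k = 0)" if "k < ?N" for k
    using Bherm[of 0 k] B0[OF that] e_real by (metis complex_cnj_complex_of_real complex_cnj_mult complex_cnj_of_nat of_nat_of_bool)
  obtain u' p' where "diagonalizes {..<n} (\<lambda>k l. B (Suc k) (Suc l)) {..<n} u' p'"
    using Suc.IH[of "\<lambda>k l. B (Suc k) (Suc l)"] Bherm by blast
  then have u': "\<And>k l. k < n \<Longrightarrow> l < n \<Longrightarrow> (\<Sum>x<n. u' k x * cnj (u' l x)) = of_bool (k = l)"
    and B_eq: "\<And>k l. k < n \<Longrightarrow> l < n \<Longrightarrow>
        B (Suc k) (Suc l) = (\<Sum>m<n. of_real (p' m) * (u' m k * cnj (u' m l)))"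
    by (simp_all add: diagonalizes_def orthonormal_basis_def)
  \<comment> \<open>Eigenvectors of the block are coefficient vectors with respect to
    \<open>w 1\<close>, ..., \<open>w n\<close>; the eigenvector \<open>w 0\<close> is kept.\<close>
  define u where "u = (\<lambda>k x. case k of 0 \<Rightarrow> w 0 x | Suc k \<Rightarrow> \<Sum>l<n. u' k l * w (Suc l) x)"
  define p where "p = (\<lambda>k. case k of 0 \<Rightarrow> Re e | Suc k \<Rightarrow> p' k)"
  have u_simps: "u 0 = w 0" "\<And>k x. u (Suc k) x = (\<Sum>l<n. u' k l * w (Suc l) x)"
    by (simp_all add: u_def fun_eq_iff)
  have inner: "(\<Sum>x<?N. w k x * cnj (u (Suc l) x)) = (\<Sum>m<n. cnj (u' l m) * of_bool (k = Suc m))"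
    if "k < ?N" for k l
  proof -
    have "(\<Sum>x<?N. w k x * cnj (u (Suc l) x)) = (\<Sum>m<n. cnj (u' l m) * (\<Sum>x<?N. w k x * cnj (w (Suc m) x)))"
      unfolding u_simps cnj_sum complex_cnj_mult sum_distrib_left
      by (subst sum.swap) (simp add: mult_ac del: sum.lessThan_Suc)
    also have "\<dots> = (\<Sum>m<n. cnj (u' l m) * of_bool (k = Suc m))"
      using that by (intro sum.cong refl, subst orth) auto
    finally show ?thesis .
  qed
  have orth0: "(\<Sum>x<?N. u 0 x * cnj (u (Suc l) x)) = 0" for l
    unfolding u_simps(1) by (subst inner) auto
  have orth0': "(\<Sum>x<?N. u (Suc l) x * cnj (u 0 x)) = 0" for l
    using arg_cong[OF orth0[of l], of cnj] by (simp add: mult.commute del: sum.lessThan_Suc)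
  have orthS: "(\<Sum>x<?N. u (Suc k) x * cnj (u (Suc l) x)) = of_bool (k = l)" if "k < n" "l < n" for k l
  proof -
    have "(\<Sum>x<?N. u (Suc k) x * cnj (u (Suc l) x))
        = (\<Sum>m<n. u' k m * (\<Sum>x<?N. w (Suc m) x * cnj (u (Suc l) x)))"
      unfolding u_simps(2)[of k] sum_distrib_left sum_distrib_right
      by (subst sum.swap) (simp add: mult_ac del: sum.lessThan_Suc)
    also have "\<dots> = (\<Sum>m<n. u' k m * cnj (u' l m))"
      by (intro sum.cong refl, subst inner) (auto simp: of_bool_def if_distrib[of "\<lambda>c. _ * c"] cong: if_cong)
    finally show ?thesis using u'[OF that] by simp
  qed
  have "(\<Sum>x<?N. u k x * cnj (u l x)) = of_bool (k = l)" if "k < ?N" "l < ?N" for k l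
    using that orth0 orth0' orthS orth[of 0 0]
    by (cases k; cases l) (auto simp: u_simps(1) simp del: sum.lessThan_Suc)
  then have onb: "orthonormal_basis {..<?N} {..<?N} u" by (rule orthonormal_basis_square)
  have "K x y = (\<Sum>k<?N. of_real (p k) * (u k x * cnj (u k y)))" if "x < ?N" "y < ?N" for x y
  proof -
    have "K x y = (\<Sum>k<?N. \<Sum>l<?N. w k x * B k l * cnj (w l y))"
      unfolding B_def using that by (intro kernel_expand[OF w]) auto
    also have "\<dots> = (\<Sum>l<?N. w 0 x * B 0 l * cnj (w l y))
        + (\<Sum>k<n. \<Sum>l<?N. w (Suc k) x * B (Suc k) l * cnj (w l y))"
      by (subst sum.lessThan_Suc_shift) simp
    also have "(\<Sum>l<?N. w 0 x * B 0 l * cnj (w l y)) = e * (w 0 x * cnj (w 0 y))"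
      by (subst sum.lessThan_Suc_shift) (simp add: B0')
    also have "(\<Sum>k<n. \<Sum>l<?N. w (Suc k) x * B (Suc k) l * cnj (w l y))
        = (\<Sum>k<n. \<Sum>l<n. w (Suc k) x * B (Suc k) (Suc l) * cnj (w (Suc l) y))"
      by (rule sum.cong[OF refl], subst sum.lessThan_Suc_shift) (simp add: B0)
    also have "\<dots> = (\<Sum>k<n. \<Sum>l<n. \<Sum>m<n.
        of_real (p' m) * ((u' m k * w (Suc k) x) * cnj (u' m l * w (Suc l) y)))"
      by (intro sum.cong refl) (simp add: B_eq sum_distrib_left sum_distrib_right mult_ac)
    also have "\<dots> = (\<Sum>k<n. \<Sum>m<n. \<Sum>l<n.
        of_real (p' m) * ((u' m k * w (Suc k) x) * cnj (u' m l * w (Suc l) y)))"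
      by (intro sum.cong refl sum.swap)
    also have "\<dots> = (\<Sum>m<n. \<Sum>k<n. \<Sum>l<n.
        of_real (p' m) * ((u' m k * w (Suc k) x) * cnj (u' m l * w (Suc l) y)))"
      by (rule sum.swap)
    also have "\<dots> = (\<Sum>m<n. of_real (p' m) * (u (Suc m) x * cnj (u (Suc m) y)))"
      by (rule sum.cong[OF refl]) (simp only: u_simps cnj_sum sum_product, simp only: sum_distrib_left)
    also have "e * (w 0 x * cnj (w 0 y)) + \<dots> = (\<Sum>k<?N. of_real (p k) * (u k x * cnj (u k y)))"
      by (subst sum.lessThan_Suc_shift) (simp add: p_def u_simps(1) e_real[symmetric])
    finally show ?thesis .
  qed
  with onb have "diagonalizes {..<?N} K {..<?N} u p"
    by (simp add: diagonalizes_def del: sum.lessThan_Suc)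
  then show ?case by blast
qed

text \<open>\<open>tr_fun\<close> reads the eigenvalues off the characteristic polynomial.
  Similarity to the diagonal matrix of \<open>p\<close> splits that polynomial into linear factors,
  so its roots with multiplicity are the values of \<open>p\<close>.\<close>

lemma tr_fun_diagonalizes:
  assumes M: "M \<in> carrier_mat n n"
    and diag: "diagonalizes {..<n} (\<lambda>x y. M $$ (x, y)) {..<n} u p"
  shows "tr_fun f M = (\<Sum>k<n. f (p k))"
proof -
  define P where "P = mat n n (\<lambda>(x, k). u k x)"
  define Q where "Q = mat n n (\<lambda>(k, x). cnj (u k x))"
  define D where "D = mat n n (\<lambda>(k, l). if k = l then complex_of_real (p k) else 0)"
  have carr: "P \<in> carrier_mat n n" "Q \<in> carrier_mat n n" "D \<in> carrier_mat n n"
    by (simp_all add: P_def Q_def D_def)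
  have onb: "(\<Sum>k<n. u k x * cnj (u k y)) = of_bool (x = y)"
    and M_eq: "M $$ (x, y) = (\<Sum>k<n. of_real (p k) * (u k x * cnj (u k y)))"
    if "x < n" "y < n" for x y
    using diag that by (simp_all add: diagonalizes_def orthonormal_basis_def)
  have PQ: "P * Q = 1\<^sub>m n"
    by (rule eq_matI) (auto simp: P_def Q_def scalar_prod_def onb lessThan_atLeast0[symmetric])
  have QP: "Q * P = 1\<^sub>m n" by (rule mat_mult_left_right_inverse[OF carr(1,2) PQ])
  have PD: "(P * D) $$ (x, k) = u k x * of_real (p k)" if "x < n" "k < n" for x k
    using that by (simp add: P_def D_def scalar_prod_def lessThan_atLeast0[symmetric]
        if_distrib[of "\<lambda>c. _ * c"] cong: if_cong)
  have "M = P * D * Q"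
  proof (rule eq_matI)
    fix x y assume "x < dim_row (P * D * Q)" "y < dim_col (P * D * Q)"
    then have xy: "x < n" "y < n" using carr by auto
    have "(P * D * Q) $$ (x, y) = (\<Sum>k<n. (P * D) $$ (x, k) * Q $$ (k, y))"
      using xy carr by (simp add: scalar_prod_def lessThan_atLeast0[symmetric] del: assoc_mult_mat)
    also have "\<dots> = M $$ (x, y)"
      using xy by (simp add: PD M_eq Q_def mult_ac)
    finally show "M $$ (x, y) = (P * D * Q) $$ (x, y)" by simp
  qed (use M carr in auto)
  then have "similar_mat M D"
    using M carr PQ QP by (intro similar_matI[of _ _ P Q n]) auto
  then have "char_poly M = char_poly D" by (rule char_poly_similar)
  also have "\<dots> = (\<Prod>a\<leftarrow>diag_mat D. [:- a, 1:])"
    by (rule char_poly_upper_triangular[OF carr(3)]) (auto simp: D_def upper_triangular_def)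
  also have "diag_mat D = map (\<lambda>k. complex_of_real (p k)) [0..<n]"
    by (auto simp: diag_mat_def D_def)
  also have "(\<Prod>a\<leftarrow>\<dots>. [:- a, 1:]) = (\<Prod>k<n. [:- complex_of_real (p k), 1:])"
    by (simp add: prod.distinct_set_conv_list[symmetric] lessThan_atLeast0 o_def)
  finally have cp: "char_poly M = (\<Prod>k<n. [:- complex_of_real (p k), 1:])" .
  have "eigs M = (\<Sum>k<n. {#complex_of_real (p k)#})"
    unfolding eigs_def cp by (subst proots_prod) auto
  moreover have "(\<Sum>e\<in>#(\<Sum>k<m. {#complex_of_real (p k)#}). f (Re e)) = (\<Sum>k<m. f (p k))" for m
    by (induction m) (simp_all add: add.commute)
  ultimately show ?thesis by (simp add: tr_fun_def)
qed

subsection \<open>Relative entropy and partial trace\<close>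

definition braket :: "'i set \<Rightarrow> ('i \<Rightarrow> complex) \<Rightarrow> ('i \<Rightarrow> complex) \<Rightarrow> complex" where
  "braket I f v = (\<Sum>x\<in>I. cnj (f x) * v x)"

definition qform :: "'i set \<Rightarrow> ('i \<Rightarrow> 'i \<Rightarrow> complex) \<Rightarrow> ('i \<Rightarrow> complex) \<Rightarrow> complex" where
  "qform I K v = (\<Sum>x\<in>I. \<Sum>y\<in>I. cnj (v x) * K x y * v y)"

lemma qform_diagonalizes:
  assumes "diagonalizes I K N u p"
  shows "qform I K v = of_real (\<Sum>k\<in>N. p k * (cmod (braket I (u k) v))\<^sup>2)"
proof -
  have "qform I K v = (\<Sum>x\<in>I. \<Sum>y\<in>I. \<Sum>k\<in>N. of_real (p k) * ((cnj (v x) * u k x) * (cnj (u k y) * v y)))"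
    unfolding qform_def using assms
    by (intro sum.cong refl) (simp add: diagonalizes_def sum_distrib_left sum_distrib_right mult_ac)
  also have "\<dots> = (\<Sum>x\<in>I. \<Sum>k\<in>N. \<Sum>y\<in>I. of_real (p k) * ((cnj (v x) * u k x) * (cnj (u k y) * v y)))"
    by (intro sum.cong refl sum.swap)
  also have "\<dots> = (\<Sum>k\<in>N. \<Sum>x\<in>I. \<Sum>y\<in>I. of_real (p k) * ((cnj (v x) * u k x) * (cnj (u k y) * v y)))"
    by (rule sum.swap)
  also have "\<dots> = (\<Sum>k\<in>N. of_real (p k) * ((\<Sum>x\<in>I. cnj (v x) * u k x) * (\<Sum>y\<in>I. cnj (u k y) * v y)))"
    by (simp only: sum_product, simp only: sum_distrib_left)
  also have "\<dots> = (\<Sum>k\<in>N. of_real (p k) * (braket I (u k) v * cnj (braket I (u k) v)))"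
    by (simp add: braket_def mult.commute)
  also have "\<dots> = of_real (\<Sum>k\<in>N. p k * (cmod (braket I (u k) v))\<^sup>2)"
    by (simp only: mult_cnj_self of_real_sum of_real_mult)
  finally show ?thesis .
qed

text \<open>The identity operator is diagonalized by every orthonormal basis, with all eigenvalues
  1, and its quadratic form is the squared norm.\<close>

lemma parseval:
  assumes "orthonormal_basis I N u" "finite I"
  shows "(\<Sum>k\<in>N. (cmod (braket I (u k) v))\<^sup>2) = (\<Sum>x\<in>I. (cmod (v x))\<^sup>2)"
proof -
  have "diagonalizes I (\<lambda>x y. of_bool (x = y)) N u (\<lambda>_. 1)"
    using assms by (auto simp: diagonalizes_def orthonormal_basis_def)
  from qform_diagonalizes[OF this, of v]
  have "complex_of_real (\<Sum>k\<in>N. (cmod (braket I (u k) v))\<^sup>2)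
      = (\<Sum>x\<in>I. \<Sum>y\<in>I. cnj (v x) * of_bool (x = y) * v y)" by (simp add: qform_def)
  also have "\<dots> = (\<Sum>x\<in>I. cnj (v x) * v x)"
    using assms(2) by (intro sum.cong refl)
      (simp add: of_bool_def if_distrib[of "\<lambda>c. _ * c"] if_distrib[of "\<lambda>c. c * _"] cong: if_cong)
  also have "\<dots> = of_real (\<Sum>x\<in>I. (cmod (v x))\<^sup>2)"
    by (simp only: of_real_sum mult_cnj_self[symmetric] mult.commute)
  finally show ?thesis by (simp only: of_real_eq_iff)
qed

text \<open>\<open>lieb_form\<close> is \<open>2 Re Tr(X\<^sup>* \<rho>) - Tr(X\<^sup>* \<sigma> X) - t Tr(X \<rho> X\<^sup>*)\<close>. Its supremum over \<open>X\<close> is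
\<open>\<langle>\<rho>, (L\<^sub>\<sigma> + t R\<^sub>\<rho>)\<^sup>-\<^sup>1 \<rho>\<rangle>\<close> (left and right multiplication), which \<open>quasi_entropy\<close> below writes in the two
eigenbases; terms with \<open>q j + t * p i = 0\<close> vanish there because \<open>u / 0 = 0\<close>.\<close>

definition lieb_form :: "real \<Rightarrow> 'i set \<Rightarrow> ('i \<Rightarrow> 'i \<Rightarrow> complex) \<Rightarrow> ('i \<Rightarrow> 'i \<Rightarrow> complex) \<Rightarrow>
    ('i \<Rightarrow> 'i \<Rightarrow> complex) \<Rightarrow> real" where
  "lieb_form t I \<rho> \<sigma> X = 2 * Re (\<Sum>x\<in>I. \<Sum>y\<in>I. cnj (X x y) * \<rho> x y)
     - Re (\<Sum>y\<in>I. qform I \<sigma> (\<lambda>x. X x y)) - t * Re (\<Sum>x\<in>I. qform I \<rho> (\<lambda>y. cnj (X x y)))"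

section \<open>The variational formula in the two eigenbases\<close>

lemma sum_swap4:
  "(\<Sum>x\<in>I. \<Sum>y\<in>J. \<Sum>i\<in>N. \<Sum>j\<in>M. g x y i j) = (\<Sum>i\<in>N. \<Sum>j\<in>M. \<Sum>x\<in>I. \<Sum>y\<in>J. g x y i j)"
proof -
  have "(\<Sum>x\<in>I. \<Sum>y\<in>J. \<Sum>i\<in>N. \<Sum>j\<in>M. g x y i j) = (\<Sum>x\<in>I. \<Sum>i\<in>N. \<Sum>y\<in>J. \<Sum>j\<in>M. g x y i j)"
    by (intro sum.cong refl sum.swap)
  also have "\<dots> = (\<Sum>i\<in>N. \<Sum>x\<in>I. \<Sum>y\<in>J. \<Sum>j\<in>M. g x y i j)" by (rule sum.swap)
  also have "\<dots> = (\<Sum>i\<in>N. \<Sum>x\<in>I. \<Sum>j\<in>M. \<Sum>y\<in>J. g x y i j)"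
    by (intro sum.cong refl sum.swap)
  also have "\<dots> = (\<Sum>i\<in>N. \<Sum>j\<in>M. \<Sum>x\<in>I. \<Sum>y\<in>J. g x y i j)"
    by (intro sum.cong refl sum.swap)
  finally show ?thesis .
qed

text \<open>In terms of the matrix elements \<open>\<xi> j i\<close> of \<open>X\<close> between the
  eigenbases the form splits into independent scalar quadratics. For the linear term,
  \<open>e i\<close> is expanded in the basis \<open>f\<close>; in each quadratic term one index is
  handled by the spectral decomposition and the other by Parseval.\<close>

lemma lieb_form_eq:
  fixes X :: "'i \<Rightarrow> 'i \<Rightarrow> complex" and N :: "'k set" and M :: "'l set"
  assumes \<rho>: "diagonalizes I \<rho> N e p" and \<sigma>: "diagonalizes I \<sigma> M f q" and fin: "finite I"
  defines "\<xi> \<equiv> (\<lambda>j i. \<Sum>x\<in>I. \<Sum>y\<in>I. cnj (f j x) * X x y * e i y)"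
  shows "lieb_form t I \<rho> \<sigma> X = (\<Sum>i\<in>N. \<Sum>j\<in>M.
     2 * p i * Re (cnj (\<xi> j i) * braket I (f j) (e i)) - (q j + t * p i) * (cmod (\<xi> j i))\<^sup>2)"
proof -
  have onb: "orthonormal_basis I N e" "orthonormal_basis I M f"
    using \<rho> \<sigma> by (simp_all add: diagonalizes_def)
  have "(\<Sum>x\<in>I. \<Sum>y\<in>I. cnj (X x y) * \<rho> x y)
      = (\<Sum>x\<in>I. \<Sum>y\<in>I. \<Sum>i\<in>N. \<Sum>j\<in>M. of_real (p i) * braket I (f j) (e i) * cnj (cnj (f j x) * X x y * e i y))"
  proof (intro sum.cong refl)
    fix x y assume "x \<in> I" "y \<in> I"
    then have "\<rho> x y = (\<Sum>i\<in>N. of_real (p i) * (e i x * cnj (e i y)))"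
      using \<rho> by (simp add: diagonalizes_def)
    also have "\<dots> = (\<Sum>i\<in>N. of_real (p i) * ((\<Sum>j\<in>M. f j x * braket I (f j) (e i)) * cnj (e i y)))"
      using orthonormal_basis_expand[OF onb(2) fin \<open>x \<in> I\<close>] by (simp add: braket_def)
    finally show "cnj (X x y) * \<rho> x y = (\<Sum>i\<in>N. \<Sum>j\<in>M. of_real (p i) * braket I (f j) (e i) * cnj (cnj (f j x) * X x y * e i y))"
      by (simp add: sum_distrib_left sum_distrib_right mult_ac)
  qed
  also have "\<dots> = (\<Sum>i\<in>N. \<Sum>j\<in>M. \<Sum>x\<in>I. \<Sum>y\<in>I. of_real (p i) * braket I (f j) (e i) * cnj (cnj (f j x) * X x y * e i y))"
    by (rule sum_swap4)
  also have "\<dots> = (\<Sum>i\<in>N. \<Sum>j\<in>M. of_real (p i) * braket I (f j) (e i) * cnj (\<xi> j i))"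
    by (simp only: \<xi>_def cnj_sum sum_distrib_left)
  finally have 1: "(\<Sum>x\<in>I. \<Sum>y\<in>I. cnj (X x y) * \<rho> x y)
      = (\<Sum>i\<in>N. \<Sum>j\<in>M. of_real (p i) * braket I (f j) (e i) * cnj (\<xi> j i))" .
  have 2: "Re (\<Sum>y\<in>I. qform I \<sigma> (\<lambda>x. X x y)) = (\<Sum>i\<in>N. \<Sum>j\<in>M. q j * (cmod (\<xi> j i))\<^sup>2)"
  proof -
    have "Re (\<Sum>y\<in>I. qform I \<sigma> (\<lambda>x. X x y)) = (\<Sum>y\<in>I. \<Sum>j\<in>M. q j * (cmod (braket I (f j) (\<lambda>x. X x y)))\<^sup>2)"
      by (simp add: qform_diagonalizes[OF \<sigma>] del: of_real_sum)
    also have "\<dots> = (\<Sum>j\<in>M. q j * (\<Sum>y\<in>I. (cmod (cnj (braket I (f j) (\<lambda>x. X x y))))\<^sup>2))"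
      by (subst sum.swap) (simp add: sum_distrib_left)
    also have "\<dots> = (\<Sum>j\<in>M. q j * (\<Sum>i\<in>N. (cmod (braket I (e i) (\<lambda>y. cnj (braket I (f j) (\<lambda>x. X x y)))))\<^sup>2))"
      by (simp only: parseval[OF onb(1) fin])
    also have "\<dots> = (\<Sum>j\<in>M. q j * (\<Sum>i\<in>N. (cmod (\<xi> j i))\<^sup>2))"
    proof -
      have "braket I (e i) (\<lambda>y. cnj (braket I (f j) (\<lambda>x. X x y))) = cnj (\<xi> j i)" for i j
        unfolding braket_def \<xi>_def cnj_sum sum_distrib_left by (subst sum.swap) (simp add: mult_ac)
      then show ?thesis by simp
    qed
    also have "\<dots> = (\<Sum>i\<in>N. \<Sum>j\<in>M. q j * (cmod (\<xi> j i))\<^sup>2)"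
      by (subst sum.swap) (simp add: sum_distrib_left)
    finally show ?thesis .
  qed
  have 3: "Re (\<Sum>x\<in>I. qform I \<rho> (\<lambda>y. cnj (X x y))) = (\<Sum>i\<in>N. \<Sum>j\<in>M. p i * (cmod (\<xi> j i))\<^sup>2)"
  proof -
    have "Re (\<Sum>x\<in>I. qform I \<rho> (\<lambda>y. cnj (X x y)))
        = (\<Sum>x\<in>I. \<Sum>i\<in>N. p i * (cmod (cnj (braket I (e i) (\<lambda>y. cnj (X x y)))))\<^sup>2)"
      by (simp add: qform_diagonalizes[OF \<rho>] del: of_real_sum)
    also have "\<dots> = (\<Sum>i\<in>N. p i * (\<Sum>x\<in>I. (cmod (cnj (braket I (e i) (\<lambda>y. cnj (X x y)))))\<^sup>2))"
      by (subst sum.swap) (simp add: sum_distrib_left)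
    also have "\<dots> = (\<Sum>i\<in>N. p i * (\<Sum>j\<in>M. (cmod (braket I (f j) (\<lambda>x. cnj (braket I (e i) (\<lambda>y. cnj (X x y))))))\<^sup>2))"
      by (simp only: parseval[OF onb(2) fin])
    also have "\<dots> = (\<Sum>i\<in>N. p i * (\<Sum>j\<in>M. (cmod (\<xi> j i))\<^sup>2))"
    proof -
      have "braket I (f j) (\<lambda>x. cnj (braket I (e i) (\<lambda>y. cnj (X x y)))) = \<xi> j i" for i j
        unfolding braket_def \<xi>_def cnj_sum sum_distrib_left by (simp add: mult_ac)
      then show ?thesis by simp
    qed
    finally show ?thesis by (simp add: sum_distrib_left)
  qed
  show ?thesis unfolding lieb_form_def 1 2 3
    by (simp add: sum_subtractf sum_distrib_left algebra_simps sum.distrib)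
qed

definition quasi_entropy :: "real \<Rightarrow> 'i set \<Rightarrow> 'k set \<Rightarrow> ('k \<Rightarrow> 'i \<Rightarrow> complex) \<Rightarrow> ('k \<Rightarrow> real) \<Rightarrow>
    'l set \<Rightarrow> ('l \<Rightarrow> 'i \<Rightarrow> complex) \<Rightarrow> ('l \<Rightarrow> real) \<Rightarrow> real" where
  "quasi_entropy t I N e p M f q =
     (\<Sum>i\<in>N. \<Sum>j\<in>M. (p i)\<^sup>2 * (cmod (braket I (f j) (e i)))\<^sup>2 / (q j + t * p i))"

text \<open>The square is completed in each matrix element separately.\<close>

lemma lieb_form_le:
  assumes \<rho>: "diagonalizes I \<rho> N e p" and \<sigma>: "diagonalizes I \<sigma> M f q" and fin: "finite I"
    and p: "\<And>i. i \<in> N \<Longrightarrow> p i \<ge> 0" and q: "\<And>j. j \<in> M \<Longrightarrow> q j \<ge> 0" and t: "t > 0"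
  shows "lieb_form t I \<rho> \<sigma> X \<le> quasi_entropy t I N e p M f q"
  unfolding lieb_form_eq[OF \<rho> \<sigma> fin] quasi_entropy_def
proof (intro sum_mono)
  fix i j assume ij: "i \<in> N" "j \<in> M"
  define z where "z = (\<Sum>x\<in>I. \<Sum>y\<in>I. cnj (f j x) * X x y * e i y)"
  define c where "c = braket I (f j) (e i)"
  define m where "m = q j + t * p i"
  have pos: "p i \<ge> 0" "q j \<ge> 0" using p q ij by auto
  have "2 * p i * Re (cnj z * c) - m * (cmod z)\<^sup>2 \<le> (p i)\<^sup>2 * (cmod c)\<^sup>2 / m"
  proof (cases "m = 0")
    case True
    \<comment> \<open>Both summands of \<open>m\<close> are nonnegative and \<open>t > 0\<close>, so
      a vanishing denominator forces \<open>p i = 0\<close>, and both sides are 0.\<close>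
    then have "p i = 0" using pos t unfolding m_def
      by (metis add_nonneg_eq_0_iff mult_eq_0_iff mult_nonneg_nonneg less_imp_le less_irrefl)
    then show ?thesis using True by simp
  next
    case False
    then have "m > 0" using pos t by (simp add: m_def less_le)
    have "Re (cnj z * c) \<le> cmod z * cmod c"
      by (metis complex_Re_le_cmod complex_mod_cnj norm_mult)
    then have "2 * p i * Re (cnj z * c) \<le> 2 * p i * (cmod z * cmod c)"
      using pos by (intro mult_left_mono) auto
    moreover have "2 * p i * (cmod z * cmod c) - m * (cmod z)\<^sup>2 \<le> (p i)\<^sup>2 * (cmod c)\<^sup>2 / m"
    proof -
      have "0 \<le> (p i * cmod c - m * cmod z)\<^sup>2" by simp
      also have "\<dots> = (p i)\<^sup>2 * (cmod c)\<^sup>2 - (2 * p i * (cmod z * cmod c) - m * (cmod z)\<^sup>2) * m"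
        by (simp add: power2_eq_square algebra_simps)
      finally show ?thesis using \<open>m > 0\<close> by (simp add: pos_le_divide_eq)
    qed
    ultimately show ?thesis by linarith
  qed
  then show "2 * p i * Re (cnj (\<Sum>x\<in>I. \<Sum>y\<in>I. cnj (f j x) * X x y * e i y) * braket I (f j) (e i))
      - (q j + t * p i) * (cmod (\<Sum>x\<in>I. \<Sum>y\<in>I. cnj (f j x) * X x y * e i y))\<^sup>2
      \<le> (p i)\<^sup>2 * (cmod (braket I (f j) (e i)))\<^sup>2 / (q j + t * p i)"
    by (simp add: z_def c_def m_def)
qed

lemma lieb_form_attained:
  assumes \<rho>: "diagonalizes I \<rho> N e p" and \<sigma>: "diagonalizes I \<sigma> M f q"
    and fin: "finite I" "finite N" "finite M"
  shows "\<exists>X. lieb_form t I \<rho> \<sigma> X = quasi_entropy t I N e p M f q"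
proof -
  have onb: "orthonormal_basis I N e" "orthonormal_basis I M f"
    using \<rho> \<sigma> by (simp_all add: diagonalizes_def)
  \<comment> \<open>The stationary point of each scalar quadratic. Where the denominator is 0,
    division by zero gives 0 and both sides of the comparison vanish.\<close>
  define z where "z = (\<lambda>j i. of_real (p i) * braket I (f j) (e i) / of_real (q j + t * p i))"
  \<comment> \<open>The operator whose matrix elements between the two eigenbases are the numbers
    \<open>z j i\<close>.\<close>
  define X where "X = (\<lambda>x y. \<Sum>i\<in>N. \<Sum>j\<in>M. z j i * (f j x * cnj (e i y)))"
  have xi: "(\<Sum>x\<in>I. \<Sum>y\<in>I. cnj (f j x) * X x y * e i y) = z j i" if "i \<in> N" "j \<in> M" for i j
  proof -
    have "(\<Sum>x\<in>I. \<Sum>y\<in>I. cnj (f j x) * X x y * e i y)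
        = (\<Sum>x\<in>I. cnj (f j x) * (\<Sum>y\<in>I. X x y * e i y))"
      by (simp add: sum_distrib_left mult.assoc)
    also have "\<dots> = (\<Sum>x\<in>I. cnj (f j x) * (\<Sum>j'\<in>M. z j' i * f j' x))"
    proof (intro sum.cong refl)
      fix x
      have "(\<Sum>y\<in>I. X x y * e i y) = (\<Sum>y\<in>I. \<Sum>i'\<in>N. (\<Sum>j'\<in>M. z j' i' * f j' x) * (e i y * cnj (e i' y)))"
        by (simp add: X_def sum_distrib_left sum_distrib_right mult_ac)
      also have "\<dots> = (\<Sum>i'\<in>N. (\<Sum>j'\<in>M. z j' i' * f j' x) * (\<Sum>y\<in>I. e i y * cnj (e i' y)))"
        by (subst sum.swap) (simp only: sum_distrib_left)
      also have "\<dots> = (\<Sum>i'\<in>N. (\<Sum>j'\<in>M. z j' i' * f j' x) * of_bool (i = i'))"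
        using onb(1) that by (intro sum.cong refl) (simp add: orthonormal_basis_def)
      also have "\<dots> = (\<Sum>j'\<in>M. z j' i * f j' x)"
        using that fin by (simp add: of_bool_def if_distrib[of "\<lambda>c. _ * c"] cong: if_cong)
      finally show "cnj (f j x) * (\<Sum>y\<in>I. X x y * e i y) = cnj (f j x) * (\<Sum>j'\<in>M. z j' i * f j' x)"
        by simp
    qed
    also have "\<dots> = (\<Sum>x\<in>I. \<Sum>j'\<in>M. z j' i * (f j' x * cnj (f j x)))"
      by (simp add: sum_distrib_left mult_ac)
    also have "\<dots> = (\<Sum>j'\<in>M. z j' i * (\<Sum>x\<in>I. f j' x * cnj (f j x)))"
      by (subst sum.swap) (simp only: sum_distrib_left)
    also have "\<dots> = (\<Sum>j'\<in>M. z j' i * of_bool (j' = j))"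
      using onb(2) that by (intro sum.cong refl) (simp add: orthonormal_basis_def)
    also have "\<dots> = z j i"
      using that fin by (simp add: of_bool_def if_distrib[of "\<lambda>c. _ * c"] cong: if_cong)
    finally show ?thesis .
  qed
  have "lieb_form t I \<rho> \<sigma> X = quasi_entropy t I N e p M f q"
    unfolding lieb_form_eq[OF \<rho> \<sigma> fin(1)] quasi_entropy_def
  proof (intro sum.cong refl)
    fix i j assume ij: "i \<in> N" "j \<in> M"
    define c where "c = braket I (f j) (e i)"
    define m where "m = q j + t * p i"
    have z: "z j i = of_real (p i / m) * c" by (simp add: z_def c_def m_def)
    have "cnj (z j i) * c = of_real (p i / m) * (c * cnj c)" unfolding z by simp
    also have "\<dots> = of_real (p i / m * (cmod c)\<^sup>2)" by (simp only: mult_cnj_self of_real_mult)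
    finally have re: "Re (cnj (z j i) * c) = p i / m * (cmod c)\<^sup>2" by (simp only: Re_complex_of_real)
    have sq: "(cmod (z j i))\<^sup>2 = (p i / m)\<^sup>2 * (cmod c)\<^sup>2"
      unfolding z norm_mult norm_of_real power_mult_distrib by (simp add: power_divide)
    have "2 * p i * Re (cnj (z j i) * c) - m * (cmod (z j i))\<^sup>2 = (p i)\<^sup>2 * (cmod c)\<^sup>2 / m"
      unfolding re sq by (cases "m = 0") (simp_all add: field_simps power2_eq_square)
    then show "2 * p i * Re (cnj (\<Sum>x\<in>I. \<Sum>y\<in>I. cnj (f j x) * X x y * e i y) * braket I (f j) (e i))
        - (q j + t * p i) * (cmod (\<Sum>x\<in>I. \<Sum>y\<in>I. cnj (f j x) * X x y * e i y))\<^sup>2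
        = (p i)\<^sup>2 * (cmod (braket I (f j) (e i)))\<^sup>2 / (q j + t * p i)"
      by (simp only: xi[OF ij] c_def m_def)
  qed
  then show ?thesis by blast
qed

section \<open>Test operators and partial traces\<close>

lemma sum_Times: "(\<Sum>x\<in>A \<times> B. h x) = (\<Sum>a\<in>A. \<Sum>b\<in>B. h (a, b))"
  by (simp add: sum.cartesian_product)

lemma sum_of_bool_fst:
  fixes g :: "'a \<times> 'b \<Rightarrow> complex"
  assumes "finite A" "a \<in> A"
  shows "(\<Sum>x\<in>A \<times> Y. of_bool (fst x = a) * g x) = (\<Sum>y\<in>Y. g (a, y))"
proof -
  have "(\<Sum>x\<in>A \<times> Y. of_bool (fst x = a) * g x) = (\<Sum>a'\<in>A. \<Sum>y\<in>Y. of_bool (a' = a) * g (a', y))"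
    by (simp add: sum.cartesian_product case_prod_unfold)
  also have "\<dots> = (\<Sum>a'\<in>A. of_bool (a' = a) * (\<Sum>y\<in>Y. g (a', y)))"
    by (simp add: sum_distrib_left)
  also have "\<dots> = (\<Sum>y\<in>Y. g (a, y))"
    using assms by (simp add: of_bool_def if_distrib[of "\<lambda>c. c * _"] cong: if_cong)
  finally show ?thesis .
qed

lemma qform_slice:
  assumes "finite A" "a \<in> A"
  shows "qform (A \<times> Y) K (\<lambda>x. of_bool (fst x = a) * v (snd x))
       = (\<Sum>y\<in>Y. \<Sum>y'\<in>Y. cnj (v y) * K (a, y) (a, y') * v y')"
proof -
  have "qform (A \<times> Y) K (\<lambda>x. of_bool (fst x = a) * v (snd x))
      = (\<Sum>x\<in>A \<times> Y. of_bool (fst x = a) *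
          (\<Sum>x'\<in>A \<times> Y. of_bool (fst x' = a) * (cnj (v (snd x)) * K x x' * v (snd x'))))"
    unfolding qform_def sum_distrib_left by (intro sum.cong refl) simp
  also have "\<dots> = (\<Sum>y\<in>Y. \<Sum>y'\<in>Y. cnj (v y) * K (a, y) (a, y') * v y')"
    by (simp only: sum_of_bool_fst[OF assms] snd_conv)
  finally show ?thesis .
qed

text \<open>A vector supported on the slice over \<open>a\<close> sees only the diagonal block of
  \<open>K\<close> at \<open>a\<close>, and these blocks add up to the partial trace.\<close>

lemma sum_qform_slice:
  assumes "finite A" and K': "\<And>y y'. y \<in> Y \<Longrightarrow> y' \<in> Y \<Longrightarrow> K' y y' = (\<Sum>a\<in>A. K (a, y) (a, y'))"
  shows "(\<Sum>a\<in>A. qform (A \<times> Y) K (\<lambda>x. of_bool (fst x = a) * v (snd x))) = qform Y K' v"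
proof -
  have "(\<Sum>a\<in>A. qform (A \<times> Y) K (\<lambda>x. of_bool (fst x = a) * v (snd x)))
      = (\<Sum>a\<in>A. \<Sum>y\<in>Y. \<Sum>y'\<in>Y. cnj (v y) * K (a, y) (a, y') * v y')"
    by (intro sum.cong refl qform_slice assms)
  also have "\<dots> = (\<Sum>y\<in>Y. \<Sum>a\<in>A. \<Sum>y'\<in>Y. cnj (v y) * K (a, y) (a, y') * v y')" by (rule sum.swap)
  also have "\<dots> = (\<Sum>y\<in>Y. \<Sum>y'\<in>Y. \<Sum>a\<in>A. cnj (v y) * K (a, y) (a, y') * v y')"
    by (intro sum.cong refl sum.swap)
  also have "\<dots> = qform Y K' v"
    unfolding qform_def by (intro sum.cong refl) (simp add: K' sum_distrib_left sum_distrib_right)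
  finally show ?thesis .
qed

text \<open>The test operator is 1 \<otimes> X. The form is linear in the pair of kernels, and
  tracing out a factor is dual to tensoring with the identity on that factor.\<close>

lemma lieb_form_partial_trace:
  assumes "finite A"
    and \<rho>: "\<And>y y'. y \<in> Y \<Longrightarrow> y' \<in> Y \<Longrightarrow> \<rho>' y y' = (\<Sum>a\<in>A. \<rho> (a, y) (a, y'))"
    and \<sigma>: "\<And>y y'. y \<in> Y \<Longrightarrow> y' \<in> Y \<Longrightarrow> \<sigma>' y y' = (\<Sum>a\<in>A. \<sigma> (a, y) (a, y'))"
  shows "lieb_form t (A \<times> Y) \<rho> \<sigma> (\<lambda>x x'. of_bool (fst x = fst x') * X (snd x) (snd x'))
       = lieb_form t Y \<rho>' \<sigma>' X"
proof -
  have 1: "(\<Sum>x\<in>A \<times> Y. \<Sum>x'\<in>A \<times> Y. cnj (of_bool (fst x = fst x') * X (snd x) (snd x')) * \<rho> x x')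
      = (\<Sum>y\<in>Y. \<Sum>y'\<in>Y. cnj (X y y') * \<rho>' y y')"
  proof -
    have "(\<Sum>x\<in>A \<times> Y. \<Sum>x'\<in>A \<times> Y. cnj (of_bool (fst x = fst x') * X (snd x) (snd x')) * \<rho> x x')
        = (\<Sum>x\<in>A \<times> Y. \<Sum>x'\<in>A \<times> Y. of_bool (fst x' = fst x) * (cnj (X (snd x) (snd x')) * \<rho> x x'))"
      by (intro sum.cong refl) auto
    also have "\<dots> = (\<Sum>x\<in>A \<times> Y. \<Sum>y'\<in>Y. cnj (X (snd x) y') * \<rho> x (fst x, y'))"
      using assms(1) by (intro sum.cong refl, subst sum_of_bool_fst) auto
    also have "\<dots> = (\<Sum>a\<in>A. \<Sum>y\<in>Y. \<Sum>y'\<in>Y. cnj (X y y') * \<rho> (a, y) (a, y'))"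
      by (simp add: sum_Times)
    also have "\<dots> = (\<Sum>y\<in>Y. \<Sum>a\<in>A. \<Sum>y'\<in>Y. cnj (X y y') * \<rho> (a, y) (a, y'))" by (rule sum.swap)
    also have "\<dots> = (\<Sum>y\<in>Y. \<Sum>y'\<in>Y. \<Sum>a\<in>A. cnj (X y y') * \<rho> (a, y) (a, y'))"
      by (intro sum.cong refl sum.swap)
    also have "\<dots> = (\<Sum>y\<in>Y. \<Sum>y'\<in>Y. cnj (X y y') * \<rho>' y y')"
      by (intro sum.cong refl) (simp add: \<rho> sum_distrib_left)
    finally show ?thesis .
  qed
  \<comment> \<open>The column of 1 \<otimes> X with index (a, y') is supported on the slice over
    \<open>a\<close>, so summing over \<open>a\<close> traces out the first factor.\<close>
  have 2: "(\<Sum>x'\<in>A \<times> Y. qform (A \<times> Y) \<sigma> (\<lambda>x. of_bool (fst x = fst x') * X (snd x) (snd x')))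
      = (\<Sum>y'\<in>Y. qform Y \<sigma>' (\<lambda>y. X y y'))"
  proof -
    have "(\<Sum>x'\<in>A \<times> Y. qform (A \<times> Y) \<sigma> (\<lambda>x. of_bool (fst x = fst x') * X (snd x) (snd x')))
        = (\<Sum>a\<in>A. \<Sum>y'\<in>Y. qform (A \<times> Y) \<sigma> (\<lambda>x. of_bool (fst x = a) * X (snd x) y'))"
      by (simp add: sum.cartesian_product case_prod_unfold)
    also have "\<dots> = (\<Sum>y'\<in>Y. \<Sum>a\<in>A. qform (A \<times> Y) \<sigma> (\<lambda>x. of_bool (fst x = a) * X (snd x) y'))"
      by (rule sum.swap)
    also have "\<dots> = (\<Sum>y'\<in>Y. qform Y \<sigma>' (\<lambda>y. X y y'))"
      by (intro sum.cong refl sum_qform_slice assms)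
    finally show ?thesis .
  qed
  \<comment> \<open>The term with \<open>\<rho>\<close> runs over conjugated rows of the test
    operator; with the equality turned around they too are slice vectors.\<close>
  have flip: "(\<lambda>x'. cnj (of_bool (fst x = fst x') * X (snd x) (snd x')))
      = (\<lambda>x'. of_bool (fst x' = fst x) * cnj (X (snd x) (snd x')))" for x :: "'a \<times> 'b"
    by (auto simp: fun_eq_iff)
  have 3: "(\<Sum>x\<in>A \<times> Y. qform (A \<times> Y) \<rho> (\<lambda>x'. cnj (of_bool (fst x = fst x') * X (snd x) (snd x'))))
      = (\<Sum>y\<in>Y. qform Y \<rho>' (\<lambda>y'. cnj (X y y')))"
  proof -
    have "(\<Sum>x\<in>A \<times> Y. qform (A \<times> Y) \<rho> (\<lambda>x'. cnj (of_bool (fst x = fst x') * X (snd x) (snd x'))))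
        = (\<Sum>a\<in>A. \<Sum>y\<in>Y. qform (A \<times> Y) \<rho> (\<lambda>x'. of_bool (fst x' = a) * cnj (X y (snd x'))))"
      unfolding flip by (simp add: sum.cartesian_product case_prod_unfold)
    also have "\<dots> = (\<Sum>y\<in>Y. \<Sum>a\<in>A. qform (A \<times> Y) \<rho> (\<lambda>x'. of_bool (fst x' = a) * cnj (X y (snd x'))))"
      by (rule sum.swap)
    also have "\<dots> = (\<Sum>y\<in>Y. qform Y \<rho>' (\<lambda>y'. cnj (X y y')))"
      by (intro sum.cong refl sum_qform_slice assms)
    finally show ?thesis .
  qed
  show ?thesis unfolding lieb_form_def 1 2 3 ..
qed

section \<open>Integration over t\<close>

text \<open>Each \<open>ln (q s + T * p s)\<close> with nonzero weight grows like
  \<open>ln T + ln (p s)\<close>, so subtracting \<open>ln T\<close> times the total weight leaves a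
  finite limit.\<close>

lemma tendsto_weighted_log_ratio:
  fixes w p q :: "'s \<Rightarrow> real"
  assumes pos: "\<And>s. s \<in> S \<Longrightarrow> w s = 0 \<or> p s > 0 \<and> q s > 0"
  shows "((\<lambda>T. (\<Sum>s\<in>S. w s * (ln (q s + T * p s) - ln (q s))) - (\<Sum>s\<in>S. w s) * ln T)
          \<longlongrightarrow> (\<Sum>s\<in>S. w s * (ln (p s) - ln (q s)))) at_top"
proof -
  have "((\<lambda>T. \<Sum>s\<in>S. w s * (ln (q s + T * p s) - ln T - ln (q s)))
          \<longlongrightarrow> (\<Sum>s\<in>S. w s * (ln (p s) - ln (q s)))) at_top"
  proof (intro tendsto_sum)
    fix s assume "s \<in> S"
    then consider "w s = 0" | "p s > 0" "q s > 0" using pos by blast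
    then show "((\<lambda>T. w s * (ln (q s + T * p s) - ln T - ln (q s))) \<longlongrightarrow> w s * (ln (p s) - ln (q s))) at_top"
    proof cases
      case 2
      have "((\<lambda>T. ln (q s + T * p s) - ln T) \<longlongrightarrow> ln (p s)) at_top"
        using 2 by real_asymp
      then show ?thesis by (intro tendsto_intros)
    qed simp
  qed
  then show ?thesis
    by (simp add: algebra_simps sum_subtractf sum.distrib sum_distrib_left sum_distrib_right)
qed

text \<open>The last hypothesis is integrated over \<open>t\<close> from 0 to \<open>T\<close>, with
  \<open>ln (q s + t * p s)\<close> as antiderivative of \<open>p s / (q s + t * p s)\<close>. Equal
  total weights make the divergent multiples of \<open>ln T\<close> agree, so the inequality
  survives as \<open>T\<close> tends to infinity.\<close>

lemma weighted_log_ratio_mono: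
  fixes w p q :: "'s \<Rightarrow> real" and w' p' q' :: "'r \<Rightarrow> real"
  assumes pos: "\<And>s. s \<in> S \<Longrightarrow> w s = 0 \<or> p s > 0 \<and> q s > 0"
    and pos': "\<And>s. s \<in> S' \<Longrightarrow> w' s = 0 \<or> p' s > 0 \<and> q' s > 0"
    and total: "(\<Sum>s\<in>S'. w' s) = (\<Sum>s\<in>S. w s)"
    and le: "\<And>t. t > 0 \<Longrightarrow> (\<Sum>s\<in>S'. w' s * (p' s / (q' s + t * p' s))) \<le> (\<Sum>s\<in>S. w s * (p s / (q s + t * p s)))"
  shows "(\<Sum>s\<in>S'. w' s * (ln (p' s) - ln (q' s))) \<le> (\<Sum>s\<in>S. w s * (ln (p s) - ln (q s)))"
proof -
  define G where "G = (\<lambda>T. \<Sum>s\<in>S. w s * (ln (q s + T * p s) - ln (q s)))"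
  define G' where "G' = (\<lambda>T. \<Sum>s\<in>S'. w' s * (ln (q' s + T * p' s) - ln (q' s)))"
  have dG: "(G has_real_derivative (\<Sum>s\<in>S. w s * (p s / (q s + T * p s)))) (at T)" if "T \<ge> 0" for T
    unfolding G_def
  proof (intro DERIV_sum)
    fix s assume "s \<in> S"
    then consider "w s = 0" | "p s > 0" "q s > 0" using pos by blast
    then show "((\<lambda>T. w s * (ln (q s + T * p s) - ln (q s))) has_real_derivative w s * (p s / (q s + T * p s))) (at T)"
    proof cases
      case 2
      then have "q s + T * p s > 0" using that by (simp add: add_pos_nonneg)
      then show ?thesis by (auto intro!: derivative_eq_intros simp: divide_inverse mult_ac)
    qed simp
  qed
  have dG': "(G' has_real_derivative (\<Sum>s\<in>S'. w' s * (p' s / (q' s + T * p' s)))) (at T)" if "T \<ge> 0" for T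
    unfolding G'_def
  proof (intro DERIV_sum)
    fix s assume "s \<in> S'"
    then consider "w' s = 0" | "p' s > 0" "q' s > 0" using pos' by blast
    then show "((\<lambda>T. w' s * (ln (q' s + T * p' s) - ln (q' s))) has_real_derivative w' s * (p' s / (q' s + T * p' s))) (at T)"
    proof cases
      case 2
      then have "q' s + T * p' s > 0" using that by (simp add: add_pos_nonneg)
      then show ?thesis by (auto intro!: derivative_eq_intros simp: divide_inverse mult_ac)
    qed simp
  qed
  \<comment> \<open>The hypothesis says that \<open>G - G'\<close>, which vanishes at 0, has nonnegative derivative.\<close>
  have G_le: "G' T \<le> G T" if "T > 0" for T
  proof -
    have "\<exists>z>0. z < T \<and> (G T - G' T) - (G 0 - G' 0) = (T - 0) *
        ((\<Sum>s\<in>S. w s * (p s / (q s + z * p s))) - (\<Sum>s\<in>S'. w' s * (p' s / (q' s + z * p' s))))"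
      using that by (intro MVT2 DERIV_diff dG dG') auto
    then obtain z where "z > 0" and z: "(G T - G' T) - (G 0 - G' 0) = T *
        ((\<Sum>s\<in>S. w s * (p s / (q s + z * p s))) - (\<Sum>s\<in>S'. w' s * (p' s / (q' s + z * p' s))))"
      by auto
    moreover have "G 0 = 0" "G' 0 = 0" by (simp_all add: G_def G'_def)
    moreover have "0 \<le> T * ((\<Sum>s\<in>S. w s * (p s / (q s + z * p s))) - (\<Sum>s\<in>S'. w' s * (p' s / (q' s + z * p' s))))"
      using that le[OF \<open>z > 0\<close>] by (intro mult_nonneg_nonneg) auto
    ultimately show ?thesis by linarith
  qed
  show ?thesis
  proof (rule tendsto_le[OF _ tendsto_weighted_log_ratio[OF pos] tendsto_weighted_log_ratio[OF pos']])
    show "\<forall>\<^sub>F T in at_top. (\<Sum>s\<in>S'. w' s * (ln (q' s + T * p' s) - ln (q' s))) - (\<Sum>s\<in>S'. w' s) * ln T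
        \<le> (\<Sum>s\<in>S. w s * (ln (q s + T * p s) - ln (q s))) - (\<Sum>s\<in>S. w s) * ln T"
      using eventually_gt_at_top[of 0] by eventually_elim (use G_le in \<open>simp add: G_def G'_def total\<close>)
  qed simp_all
qed

text \<open>This is \<open>Tr \<rho> (ln \<rho> - ln \<sigma>)\<close> only if the support of \<open>\<rho>\<close> lies in that of \<open>\<sigma>\<close>; otherwise
\<open>ln 0 = 0\<close> silently replaces the value infinity.\<close>

definition rel_entropy :: "'i set \<Rightarrow> 'k set \<Rightarrow> ('k \<Rightarrow> 'i \<Rightarrow> complex) \<Rightarrow> ('k \<Rightarrow> real) \<Rightarrow>
    'l set \<Rightarrow> ('l \<Rightarrow> 'i \<Rightarrow> complex) \<Rightarrow> ('l \<Rightarrow> real) \<Rightarrow> real" where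
  "rel_entropy I N e p M f q =
     (\<Sum>i\<in>N. \<Sum>j\<in>M. p i * (cmod (braket I (f j) (e i)))\<^sup>2 * (ln (p i) - ln (q j)))"

section \<open>Monotonicity under the partial trace\<close>

lemma norm_braket_commute: "cmod (braket I f v) = cmod (braket I v f)"
proof -
  have "braket I f v = cnj (braket I v f)" by (simp add: braket_def mult.commute)
  then show ?thesis by simp
qed

lemma braket_self:
  assumes "orthonormal_basis I N u" "k \<in> N" "l \<in> N"
  shows "braket I (u k) (u l) = of_bool (k = l)"
  using assms by (auto simp: orthonormal_basis_def braket_def mult.commute)

text \<open>Parseval in the basis \<open>f\<close> for the unit vector \<open>e i\<close>.\<close>

lemma sum_overlap:
  assumes "orthonormal_basis I N e" "orthonormal_basis I M f" "finite I" "i \<in> N"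
  shows "(\<Sum>j\<in>M. (cmod (braket I (f j) (e i)))\<^sup>2) = 1"
proof -
  have "complex_of_real (\<Sum>x\<in>I. (cmod (e i x))\<^sup>2) = (\<Sum>x\<in>I. e i x * cnj (e i x))"
    by (simp only: mult_cnj_self of_real_sum)
  also have "\<dots> = 1" using assms(1,4) by (simp add: orthonormal_basis_def)
  finally have "(\<Sum>x\<in>I. (cmod (e i x))\<^sup>2) = 1" by (simp only: of_real_eq_1_iff)
  then show ?thesis using parseval[OF assms(2,3)] by simp
qed

lemma trace_diagonalizes:
  assumes "diagonalizes I K N u p"
  shows "(\<Sum>x\<in>I. K x x) = of_real (\<Sum>k\<in>N. p k)"
proof -
  have "(\<Sum>x\<in>I. K x x) = (\<Sum>x\<in>I. \<Sum>k\<in>N. of_real (p k) * (u k x * cnj (u k x)))"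
    using assms by (intro sum.cong refl) (simp add: diagonalizes_def)
  also have "\<dots> = (\<Sum>k\<in>N. of_real (p k) * (\<Sum>x\<in>I. u k x * cnj (u k x)))"
    by (subst sum.swap) (simp only: sum_distrib_left)
  also have "\<dots> = of_real (\<Sum>k\<in>N. p k)"
    using assms by (simp add: diagonalizes_def orthonormal_basis_def)
  finally show ?thesis .
qed

text \<open>An optimal test operator X for the traced pair gives the test operator 1 \<otimes> X for
  the original pair with the same value, so the quasi-entropies are ordered for each
  \<open>t > 0\<close>; integration over \<open>t\<close> then orders the relative entropies. The
  support conditions give weight 0 to every term in which the value \<open>ln 0 = 0\<close> would
  enter.\<close>

theorem rel_entropy_partial_trace_le:
  assumes \<rho>: "diagonalizes (A \<times> Y) \<rho> N e p" and \<sigma>: "diagonalizes (A \<times> Y) \<sigma> M f q"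
    and \<rho>': "diagonalizes Y \<rho>' N' e' p'" and \<sigma>': "diagonalizes Y \<sigma>' M' f' q'"
    and pt\<rho>: "\<And>y y'. y \<in> Y \<Longrightarrow> y' \<in> Y \<Longrightarrow> \<rho>' y y' = (\<Sum>a\<in>A. \<rho> (a, y) (a, y'))"
    and pt\<sigma>: "\<And>y y'. y \<in> Y \<Longrightarrow> y' \<in> Y \<Longrightarrow> \<sigma>' y y' = (\<Sum>a\<in>A. \<sigma> (a, y) (a, y'))"
    and fin: "finite A" "finite Y" "finite N" "finite M" "finite N'" "finite M'"
    and p: "\<And>i. i \<in> N \<Longrightarrow> p i \<ge> 0" and q: "\<And>j. j \<in> M \<Longrightarrow> q j \<ge> 0"
    and p': "\<And>i. i \<in> N' \<Longrightarrow> p' i \<ge> 0" and q': "\<And>j. j \<in> M' \<Longrightarrow> q' j \<ge> 0"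
    and supp: "\<And>i j. i \<in> N \<Longrightarrow> j \<in> M \<Longrightarrow> p i > 0 \<Longrightarrow> q j = 0 \<Longrightarrow> braket (A \<times> Y) (f j) (e i) = 0"
    and supp': "\<And>i j. i \<in> N' \<Longrightarrow> j \<in> M' \<Longrightarrow> p' i > 0 \<Longrightarrow> q' j = 0 \<Longrightarrow> braket Y (f' j) (e' i) = 0"
  shows "rel_entropy Y N' e' p' M' f' q' \<le> rel_entropy (A \<times> Y) N e p M f q"
proof -
  \<comment> \<open>Both entropies are sums over pairs of eigenvectors with these weights: the
    quasi-entropy has summands \<open>p i / (q j + t * p i)\<close>, the relative entropy
    \<open>ln (p i) - ln (q j)\<close>. The total weight is the trace, which the partial trace
    preserves.\<close>
  define w where "w = (\<lambda>(i, j). p i * (cmod (braket (A \<times> Y) (f j) (e i)))\<^sup>2)"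
  define w' where "w' = (\<lambda>(i, j). p' i * (cmod (braket Y (f' j) (e' i)))\<^sup>2)"
  have finI: "finite (A \<times> Y)" using fin by simp
  have "(\<Sum>s\<in>N' \<times> M'. w' s * (ln (p' (fst s)) - ln (q' (snd s))))
      \<le> (\<Sum>s\<in>N \<times> M. w s * (ln (p (fst s)) - ln (q (snd s))))"
  proof (rule weighted_log_ratio_mono)
    fix s assume "s \<in> N \<times> M"
    then show "w s = 0 \<or> p (fst s) > 0 \<and> q (snd s) > 0"
      using p[of "fst s"] q[of "snd s"] supp[of "fst s" "snd s"]
      by (auto simp: w_def case_prod_unfold mem_Times_iff less_le)
  next
    fix s assume "s \<in> N' \<times> M'"
    then show "w' s = 0 \<or> p' (fst s) > 0 \<and> q' (snd s) > 0"
      using p'[of "fst s"] q'[of "snd s"] supp'[of "fst s" "snd s"]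
      by (auto simp: w'_def case_prod_unfold mem_Times_iff less_le)
  next
    have "(\<Sum>s\<in>N \<times> M. w s) = (\<Sum>i\<in>N. p i * (\<Sum>j\<in>M. (cmod (braket (A \<times> Y) (f j) (e i)))\<^sup>2))"
      unfolding w_def sum.cartesian_product[symmetric] by (simp add: sum_distrib_left)
    also have "\<dots> = (\<Sum>i\<in>N. p i)"
      using \<rho> \<sigma> finI by (intro sum.cong refl) (simp add: sum_overlap[of _ N _ M] diagonalizes_def)
    finally have 1: "(\<Sum>s\<in>N \<times> M. w s) = (\<Sum>i\<in>N. p i)" .
    have "(\<Sum>s\<in>N' \<times> M'. w' s) = (\<Sum>i\<in>N'. p' i * (\<Sum>j\<in>M'. (cmod (braket Y (f' j) (e' i)))\<^sup>2))"
      unfolding w'_def sum.cartesian_product[symmetric] by (simp add: sum_distrib_left)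
    also have "\<dots> = (\<Sum>i\<in>N'. p' i)"
      using \<rho>' \<sigma>' fin(2) by (intro sum.cong refl) (simp add: sum_overlap[of _ N' _ M'] diagonalizes_def)
    finally have 2: "(\<Sum>s\<in>N' \<times> M'. w' s) = (\<Sum>i\<in>N'. p' i)" .
    have "complex_of_real (\<Sum>i\<in>N'. p' i) = (\<Sum>y\<in>Y. \<Sum>a\<in>A. \<rho> (a, y) (a, y))"
      by (simp add: trace_diagonalizes[OF \<rho>', symmetric] pt\<rho> del: of_real_sum)
    also have "\<dots> = (\<Sum>x\<in>A \<times> Y. \<rho> x x)"
      by (subst sum.swap) (simp add: sum.cartesian_product case_prod_unfold)
    also have "\<dots> = complex_of_real (\<Sum>i\<in>N. p i)" by (rule trace_diagonalizes[OF \<rho>])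
    finally show "(\<Sum>s\<in>N' \<times> M'. w' s) = (\<Sum>s\<in>N \<times> M. w s)"
      unfolding 1 2 by (simp only: of_real_eq_iff)
  next
    fix t :: real assume t: "t > 0"
    obtain X where X: "lieb_form t Y \<rho>' \<sigma>' X = quasi_entropy t Y N' e' p' M' f' q'"
      using lieb_form_attained[OF \<rho>' \<sigma>' fin(2,5,6)] by blast
    have "(\<Sum>s\<in>N' \<times> M'. w' s * (p' (fst s) / (q' (snd s) + t * p' (fst s))))
        = quasi_entropy t Y N' e' p' M' f' q'"
      by (simp add: quasi_entropy_def w'_def sum.cartesian_product case_prod_unfold power2_eq_square mult_ac)
    also have "\<dots> = lieb_form t (A \<times> Y) \<rho> \<sigma> (\<lambda>x x'. of_bool (fst x = fst x') * X (snd x) (snd x'))"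
      unfolding X[symmetric] by (rule lieb_form_partial_trace[symmetric]) (simp_all add: fin pt\<rho> pt\<sigma>)
    also have "\<dots> \<le> quasi_entropy t (A \<times> Y) N e p M f q"
      by (rule lieb_form_le[OF \<rho> \<sigma> finI p q t])
    also have "\<dots> = (\<Sum>s\<in>N \<times> M. w s * (p (fst s) / (q (snd s) + t * p (fst s))))"
      by (simp add: quasi_entropy_def w_def sum.cartesian_product case_prod_unfold power2_eq_square mult_ac)
    finally show "(\<Sum>s\<in>N' \<times> M'. w' s * (p' (fst s) / (q' (snd s) + t * p' (fst s))))
        \<le> (\<Sum>s\<in>N \<times> M. w s * (p (fst s) / (q (snd s) + t * p (fst s))))" .
  qed
  then show ?thesis
    by (simp add: rel_entropy_def w_def w'_def sum.cartesian_product case_prod_unfold)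
qed

subsection \<open>Strong subadditivity\<close>

lemma diagonalizes_reindex:
  assumes "bij_betw \<phi> I' I" "diagonalizes I K N u p"
  shows "diagonalizes I' (\<lambda>x y. K (\<phi> x) (\<phi> y)) N (\<lambda>k x. u k (\<phi> x)) p"
proof -
  have "\<phi> x = \<phi> y \<longleftrightarrow> x = y" if "x \<in> I'" "y \<in> I'" for x y
    using assms(1) that by (auto simp: bij_betw_def inj_on_def)
  moreover have "\<phi> x \<in> I" if "x \<in> I'" for x using assms(1) that by (auto simp: bij_betw_def)
  moreover have "(\<Sum>x\<in>I'. u k (\<phi> x) * cnj (u l (\<phi> x))) = (\<Sum>x\<in>I. u k x * cnj (u l x))" for k l
    by (rule sum.reindex_bij_betw[OF assms(1)])
  ultimately show ?thesis
    using assms(2) by (simp add: diagonalizes_def orthonormal_basis_def)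
qed

lemma braket_reindex:
  assumes "bij_betw \<phi> I' I"
  shows "braket I' (\<lambda>x. f (\<phi> x)) (\<lambda>x. v (\<phi> x)) = braket I f v"
  unfolding braket_def by (rule sum.reindex_bij_betw[OF assms])

text \<open>The eigenvectors are products of a basis vector of \<open>B\<close> with an eigenvector
  of \<open>K\<close>; the eigenvalue depends on the second factor only.\<close>

lemma diagonalizes_one_tensor:
  fixes B :: "'b set" and Z :: "'z set" and M :: "'l set"
  assumes f: "diagonalizes Z K M f q" and "finite B" "finite Z"
  shows "diagonalizes (B \<times> Z) (\<lambda>x y. of_bool (fst x = fst y) * K (snd x) (snd y)) (B \<times> M)
           (\<lambda>s x. of_bool (fst x = fst s) * f (snd s) (snd x)) (\<lambda>s. q (snd s))"
proof -
  let ?F = "\<lambda>s x. of_bool (fst x = fst s) * f (snd s) (snd x)"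
  have "(\<Sum>x\<in>B \<times> Z. ?F s x * cnj (?F s' x)) = of_bool (s = s')" if "s \<in> B \<times> M" "s' \<in> B \<times> M" for s s'
  proof -
    have "(\<Sum>x\<in>B \<times> Z. ?F s x * cnj (?F s' x)) = (\<Sum>x\<in>B \<times> Z. of_bool (fst x = fst s) *
        (of_bool (fst x = fst s') * (f (snd s) (snd x) * cnj (f (snd s') (snd x)))))"
      by (intro sum.cong refl) simp
    also have "\<dots> = (\<Sum>z\<in>Z. of_bool (fst s = fst s') * (f (snd s) z * cnj (f (snd s') z)))"
      using that assms(2) by (subst sum_of_bool_fst) auto
    also have "\<dots> = of_bool (fst s = fst s') * of_bool (snd s = snd s')"
      using f that by (auto simp: sum_distrib_left[symmetric] diagonalizes_def orthonormal_basis_def)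
    finally show ?thesis by (auto simp: prod_eq_iff)
  qed
  \<comment> \<open>Arbitrary coefficients serve two purposes: \<open>c = 1\<close> gives
    completeness, \<open>c = q\<close> the spectral decomposition.\<close>
  moreover have "(\<Sum>s\<in>B \<times> M. of_real (c (snd s)) * (?F s x * cnj (?F s y)))
      = of_bool (fst x = fst y) * (\<Sum>j\<in>M. of_real (c j) * (f j (snd x) * cnj (f j (snd y))))"
    if "x \<in> B \<times> Z" "y \<in> B \<times> Z" for x y and c :: "'l \<Rightarrow> real"
  proof -
    have "(\<Sum>s\<in>B \<times> M. of_real (c (snd s)) * (?F s x * cnj (?F s y)))
        = (\<Sum>s\<in>B \<times> M. of_bool (fst s = fst x) *
            (of_bool (fst s = fst y) * (of_real (c (snd s)) * (f (snd s) (snd x) * cnj (f (snd s) (snd y))))))"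
      by (intro sum.cong refl) auto
    also have "\<dots> = (\<Sum>j\<in>M. of_bool (fst x = fst y) * (of_real (c j) * (f j (snd x) * cnj (f j (snd y)))))"
      using that assms(2) by (subst sum_of_bool_fst) auto
    finally show ?thesis by (simp add: sum_distrib_left)
  qed note * = this
  have "(\<Sum>s\<in>B \<times> M. ?F s x * cnj (?F s y)) = of_bool (x = y)" if "x \<in> B \<times> Z" "y \<in> B \<times> Z" for x y
    using *[OF that, of "\<lambda>_. 1"] f that
    by (auto simp: diagonalizes_def orthonormal_basis_def prod_eq_iff)
  moreover have "of_bool (fst x = fst y) * K (snd x) (snd y) = (\<Sum>s\<in>B \<times> M. of_real (q (snd s)) * (?F s x * cnj (?F s y)))"
    if "x \<in> B \<times> Z" "y \<in> B \<times> Z" for x y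
    using *[OF that, of q] f that by (auto simp: diagonalizes_def)
  ultimately show ?thesis unfolding diagonalizes_def orthonormal_basis_def by blast
qed

section \<open>An operator compared with its partial trace tensored with the identity\<close>

context
  fixes B :: "'b set" and Z :: "'z set" and K e p KZ f q and N :: "'k set" and M :: "'l set"
    and F :: "'b \<times> 'l \<Rightarrow> 'b \<times> 'z \<Rightarrow> complex"
  assumes K: "diagonalizes (B \<times> Z) K N e p" and KZ: "diagonalizes Z KZ M f q"
    and pt: "\<And>z z'. z \<in> Z \<Longrightarrow> z' \<in> Z \<Longrightarrow> KZ z z' = (\<Sum>b\<in>B. K (b, z) (b, z'))"
    and fin: "finite B" "finite Z" "finite N" "finite M"
    and p: "\<And>i. i \<in> N \<Longrightarrow> p i \<ge> 0"
  defines "F \<equiv> \<lambda>s x. of_bool (fst x = fst s) * f (snd s) (snd x)"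
begin

text \<open>The sum is the expectation of \<open>K\<close> in the vectors \<open>F (b, j)\<close>,
  summed over \<open>b\<close>. By the partial trace this is the expectation of \<open>KZ\<close> in
  its own eigenvector \<open>f j\<close>.\<close>

lemma overlap_one_tensor:
  assumes "j \<in> M"
  shows "(\<Sum>b\<in>B. \<Sum>i\<in>N. p i * (cmod (braket (B \<times> Z) (F (b, j)) (e i)))\<^sup>2) = q j"
proof -
  have onb: "orthonormal_basis Z M f" using KZ by (simp add: diagonalizes_def)
  have "complex_of_real (\<Sum>b\<in>B. \<Sum>i\<in>N. p i * (cmod (braket (B \<times> Z) (F (b, j)) (e i)))\<^sup>2)
      = (\<Sum>b\<in>B. qform (B \<times> Z) K (F (b, j)))"
    unfolding norm_braket_commute[of _ "F _"] by (simp only: qform_diagonalizes[OF K] of_real_sum)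
  also have "\<dots> = qform Z KZ (f j)"
    unfolding F_def fst_conv snd_conv by (rule sum_qform_slice) (simp_all add: fin pt)
  also have "\<dots> = of_real (\<Sum>k\<in>M. q k * (cmod (braket Z (f k) (f j)))\<^sup>2)"
    by (rule qform_diagonalizes[OF KZ])
  also have "(\<Sum>k\<in>M. q k * (cmod (braket Z (f k) (f j)))\<^sup>2) = (\<Sum>k\<in>M. if k = j then q k else 0)"
    using assms by (intro sum.cong refl) (simp add: braket_self[OF onb])
  also have "\<dots> = q j" using assms fin by simp
  finally show ?thesis by (simp only: of_real_eq_iff)
qed

lemma one_tensor_eigenvalue_nonneg: "j \<in> M \<Longrightarrow> q j \<ge> 0"
  unfolding overlap_one_tensor[symmetric] using p by (intro sum_nonneg) simp

text \<open>The nonnegative terms in \<open>overlap_one_tensor\<close> add up to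
  \<open>q (snd s) = 0\<close>, so each vanishes. This is the support condition for the relative
  entropy.\<close>

lemma one_tensor_support:
  assumes "i \<in> N" "s \<in> B \<times> M" "p i > 0" "q (snd s) = 0"
  shows "braket (B \<times> Z) (F s) (e i) = 0"
proof -
  obtain b j where s: "s = (b, j)" "b \<in> B" "j \<in> M" using assms(2) by auto
  have "(\<Sum>b\<in>B. \<Sum>i\<in>N. p i * (cmod (braket (B \<times> Z) (F (b, j)) (e i)))\<^sup>2) = 0"
    using overlap_one_tensor[OF s(3)] assms(4) s by simp
  then have "(\<Sum>i\<in>N. p i * (cmod (braket (B \<times> Z) (F (b, j)) (e i)))\<^sup>2) = 0"
    using s(2) p fin by (subst (asm) sum_nonneg_eq_0_iff) (auto intro!: sum_nonneg)
  then have "p i * (cmod (braket (B \<times> Z) (F (b, j)) (e i)))\<^sup>2 = 0"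
    using assms(1) p fin by (subst (asm) sum_nonneg_eq_0_iff) auto
  then show ?thesis using assms(3) s by simp
qed

text \<open>Since Tr K ln(1 \<otimes> KZ) = Tr KZ ln KZ, this relative entropy is a difference of
  entropies, namely the negative conditional entropy.\<close>

lemma rel_entropy_one_tensor:
  "rel_entropy (B \<times> Z) N e p (B \<times> M) F (\<lambda>s. q (snd s)) = (\<Sum>i\<in>N. p i * ln (p i)) - (\<Sum>j\<in>M. q j * ln (q j))"
proof -
  let ?W = "\<lambda>i s. (cmod (braket (B \<times> Z) (F s) (e i)))\<^sup>2"
  have onb: "orthonormal_basis (B \<times> Z) N e" "orthonormal_basis (B \<times> Z) (B \<times> M) F"
    using K diagonalizes_one_tensor[OF KZ fin(1,2)] by (simp_all add: diagonalizes_def F_def)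
  have "rel_entropy (B \<times> Z) N e p (B \<times> M) F (\<lambda>s. q (snd s))
      = (\<Sum>i\<in>N. p i * ln (p i) * (\<Sum>s\<in>B \<times> M. ?W i s)) - (\<Sum>i\<in>N. \<Sum>s\<in>B \<times> M. p i * ?W i s * ln (q (snd s)))"
    unfolding rel_entropy_def by (simp add: sum_subtractf[symmetric] sum_distrib_left algebra_simps)
  also have "(\<Sum>i\<in>N. p i * ln (p i) * (\<Sum>s\<in>B \<times> M. ?W i s)) = (\<Sum>i\<in>N. p i * ln (p i))"
    using fin by (intro sum.cong refl) (simp add: sum_overlap[OF onb])
  also have "(\<Sum>i\<in>N. \<Sum>s\<in>B \<times> M. p i * ?W i s * ln (q (snd s))) = (\<Sum>s\<in>B \<times> M. (\<Sum>i\<in>N. p i * ?W i s) * ln (q (snd s)))"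
    by (subst sum.swap) (simp add: sum_distrib_right)
  also have "\<dots> = (\<Sum>b\<in>B. \<Sum>j\<in>M. (\<Sum>i\<in>N. p i * ?W i (b, j)) * ln (q j))"
    by (simp add: sum_Times)
  also have "\<dots> = (\<Sum>j\<in>M. (\<Sum>b\<in>B. \<Sum>i\<in>N. p i * ?W i (b, j)) * ln (q j))"
    by (subst sum.swap) (simp add: sum_distrib_right)
  also have "\<dots> = (\<Sum>j\<in>M. q j * ln (q j))" by (intro sum.cong refl) (simp add: overlap_one_tensor)
  finally show ?thesis .
qed

end

text \<open>Both sides are relative entropies against an identity on B tensored with a marginal: of
  ABR against the AR marginal on the right, of BR against the R marginal on the left. Tracing out A
  takes the first pair to the second.\<close>

theorem strong_subadditivity_kernel:
  fixes A :: "'a set" and B :: "'b set" and R :: "'r set"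
  assumes ABR: "diagonalizes (A \<times> B \<times> R) \<rho> N e p"
    and AR: "diagonalizes (A \<times> R) \<rho>AR M f q"
    and BR: "diagonalizes (B \<times> R) \<rho>BR N' e' p'"
    and R: "diagonalizes R \<rho>R M' f' q'"
    and ptB: "\<And>a r a' r'. a \<in> A \<Longrightarrow> r \<in> R \<Longrightarrow> a' \<in> A \<Longrightarrow> r' \<in> R \<Longrightarrow>
        \<rho>AR (a, r) (a', r') = (\<Sum>b\<in>B. \<rho> (a, b, r) (a', b, r'))"
    and ptA: "\<And>x y. x \<in> B \<times> R \<Longrightarrow> y \<in> B \<times> R \<Longrightarrow> \<rho>BR x y = (\<Sum>a\<in>A. \<rho> (a, x) (a, y))"
    and ptAB: "\<And>r r'. r \<in> R \<Longrightarrow> r' \<in> R \<Longrightarrow> \<rho>R r r' = (\<Sum>b\<in>B. \<rho>BR (b, r) (b, r'))"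
    and fin: "finite A" "finite B" "finite R" "finite N" "finite M" "finite N'" "finite M'"
    and p: "\<And>i. i \<in> N \<Longrightarrow> p i \<ge> 0" and p': "\<And>i. i \<in> N' \<Longrightarrow> p' i \<ge> 0"
  shows "(\<Sum>i\<in>N'. p' i * ln (p' i)) - (\<Sum>j\<in>M'. q' j * ln (q' j))
       \<le> (\<Sum>i\<in>N. p i * ln (p i)) - (\<Sum>j\<in>M. q j * ln (q j))"
proof -
  \<comment> \<open>\<open>rel_entropy_partial_trace_le\<close> traces out the first factor, here A,
    while the lemmas on 1 \<otimes> KZ have the identity factor, here B, in front;
    \<open>\<phi>\<close> and \<open>\<psi>\<close> pass between the two orders.\<close>
  define \<phi> where "\<phi> = (\<lambda>(b :: 'b, a :: 'a, r :: 'r). (a, b, r))"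
  define \<psi> where "\<psi> = (\<lambda>(a :: 'a, b :: 'b, r :: 'r). (b, a, r))"
  have \<phi>: "bij_betw \<phi> (B \<times> A \<times> R) (A \<times> B \<times> R)" and \<psi>: "bij_betw \<psi> (A \<times> B \<times> R) (B \<times> A \<times> R)"
    by (rule bij_betwI[where g = \<psi>] bij_betwI[where g = \<phi>]; auto simp: \<phi>_def \<psi>_def)+
  have \<phi>\<psi>: "\<phi> (\<psi> x) = x" for x by (simp add: \<phi>_def \<psi>_def split: prod.split)
  define F where "F = (\<lambda>s (x :: 'b \<times> 'a \<times> 'r). of_bool (fst x = fst s) * f (snd s) (snd x))"
  define F' where "F' = (\<lambda>s (x :: 'b \<times> 'r). of_bool (fst x = fst s) * f' (snd s) (snd x))"
  note BAR = diagonalizes_reindex[OF \<phi> ABR]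
  have finAR: "finite (A \<times> R)" using fin by simp
  have pt: "\<rho>AR z z' = (\<Sum>b\<in>B. \<rho> (\<phi> (b, z)) (\<phi> (b, z')))" if "z \<in> A \<times> R" "z' \<in> A \<times> R" for z z'
    using that ptB by (auto simp: \<phi>_def)
  have q: "q j \<ge> 0" if "j \<in> M" for j
    by (rule one_tensor_eigenvalue_nonneg[OF BAR AR pt fin(2) finAR fin(4,5) p that])
  have q': "q' j \<ge> 0" if "j \<in> M'" for j
    by (rule one_tensor_eigenvalue_nonneg[OF BR R ptAB fin(2,3,6,7) p' that])
  have \<sigma>: "diagonalizes (A \<times> B \<times> R)
      (\<lambda>x y. of_bool (fst (\<psi> x) = fst (\<psi> y)) * \<rho>AR (snd (\<psi> x)) (snd (\<psi> y)))
      (B \<times> M) (\<lambda>s x. F s (\<psi> x)) (\<lambda>s. q (snd s))"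
    unfolding F_def by (rule diagonalizes_reindex[OF \<psi> diagonalizes_one_tensor[OF AR fin(2) finAR]])
  have \<sigma>': "diagonalizes (B \<times> R) (\<lambda>x y. of_bool (fst x = fst y) * \<rho>R (snd x) (snd y))
      (B \<times> M') F' (\<lambda>s. q' (snd s))"
    unfolding F'_def by (rule diagonalizes_one_tensor[OF R fin(2,3)])
  have brak: "braket (A \<times> B \<times> R) (\<lambda>x. F s (\<psi> x)) (e i) = braket (B \<times> A \<times> R) (F s) (\<lambda>x. e i (\<phi> x))" for s i
    using braket_reindex[OF \<psi>, of "F s" "\<lambda>x. e i (\<phi> x)"] by (simp add: \<phi>\<psi>)
  have "rel_entropy (B \<times> R) N' e' p' (B \<times> M') F' (\<lambda>s. q' (snd s))
      \<le> rel_entropy (A \<times> B \<times> R) N e p (B \<times> M) (\<lambda>s x. F s (\<psi> x)) (\<lambda>s. q (snd s))"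
  proof (rule rel_entropy_partial_trace_le[OF ABR \<sigma> BR \<sigma>' ptA])
    fix y y' assume "y \<in> B \<times> R" "y' \<in> B \<times> R"
    then have yy: "fst y \<in> B" "snd y \<in> R" "fst y' \<in> B" "snd y' \<in> R" by auto
    \<comment> \<open>\<open>\<rho>R\<close> is given as the trace of \<open>\<rho>BR\<close> over
      B; exchanging the sums shows that it is also the trace of \<open>\<rho>AR\<close> over
      A.\<close>
    have "\<rho>R (snd y) (snd y') = (\<Sum>b\<in>B. \<Sum>a\<in>A. \<rho> (a, b, snd y) (a, b, snd y'))"
      using yy by (simp add: ptAB ptA)
    also have "\<dots> = (\<Sum>a\<in>A. \<rho>AR (a, snd y) (a, snd y'))"
      using yy by (subst sum.swap) (simp add: ptB)
    finally show "of_bool (fst y = fst y') * \<rho>R (snd y) (snd y')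
        = (\<Sum>a\<in>A. of_bool (fst (\<psi> (a, y)) = fst (\<psi> (a, y'))) * \<rho>AR (snd (\<psi> (a, y))) (snd (\<psi> (a, y'))))"
      by (simp add: \<psi>_def sum_distrib_left case_prod_unfold)
  next
    fix i s assume *: "i \<in> N" "s \<in> B \<times> M" "p i > 0" "q (snd s) = 0"
    show "braket (A \<times> B \<times> R) (\<lambda>x. F s (\<psi> x)) (e i) = 0"
      unfolding brak unfolding F_def by (rule one_tensor_support[OF BAR AR pt fin(2) finAR fin(4,5) p *])
  next
    fix i s assume *: "i \<in> N'" "s \<in> B \<times> M'" "p' i > 0" "q' (snd s) = 0"
    show "braket (B \<times> R) (F' s) (e' i) = 0"
      unfolding F'_def by (rule one_tensor_support[OF BR R ptAB fin(2,3,6,7) p' *])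
  qed (use fin p p' q q' in auto)
  also have "\<dots> = rel_entropy (B \<times> A \<times> R) N (\<lambda>i x. e i (\<phi> x)) p (B \<times> M) F (\<lambda>s. q (snd s))"
    by (simp add: rel_entropy_def brak)
  also have "\<dots> = (\<Sum>i\<in>N. p i * ln (p i)) - (\<Sum>j\<in>M. q j * ln (q j))"
    unfolding F_def by (rule rel_entropy_one_tensor[OF BAR AR pt fin(2) finAR fin(4,5) p])
  also have "rel_entropy (B \<times> R) N' e' p' (B \<times> M') F' (\<lambda>s. q' (snd s))
      = (\<Sum>i\<in>N'. p' i * ln (p' i)) - (\<Sum>j\<in>M'. q' j * ln (q' j))"
    unfolding F'_def by (rule rel_entropy_one_tensor[OF BR R ptAB fin(2,3,6,7) p'])
  finally show ?thesis .
qed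

section \<open>Positive semidefinite kernels\<close>

definition pos_kernel :: "'i set \<Rightarrow> ('i \<Rightarrow> 'i \<Rightarrow> complex) \<Rightarrow> bool" where
  "pos_kernel I K \<longleftrightarrow> (\<forall>v. Im (qform I K v) = 0 \<and> Re (qform I K v) \<ge> 0)"

lemma pos_kernel_cong:
  assumes "pos_kernel I K" "\<And>x y. x \<in> I \<Longrightarrow> y \<in> I \<Longrightarrow> K' x y = K x y"
  shows "pos_kernel I K'"
proof -
  have "qform I K' v = qform I K v" for v
    unfolding qform_def using assms(2) by (intro sum.cong refl) simp
  then show ?thesis using assms(1) by (simp add: pos_kernel_def)
qed

lemma pos_kernel_reindex:
  assumes "bij_betw \<phi> I' I" "pos_kernel I K"
  shows "pos_kernel I' (\<lambda>x y. K (\<phi> x) (\<phi> y))"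
proof -
  have "qform I' (\<lambda>x y. K (\<phi> x) (\<phi> y)) v = qform I K (\<lambda>x. v (inv_into I' \<phi> x))" for v
  proof -
    have "qform I K (\<lambda>x. v (inv_into I' \<phi> x))
        = (\<Sum>x\<in>I'. \<Sum>y\<in>I'. cnj (v (inv_into I' \<phi> (\<phi> x))) * K (\<phi> x) (\<phi> y) * v (inv_into I' \<phi> (\<phi> y)))"
      unfolding qform_def by (simp only: sum.reindex_bij_betw[OF assms(1), symmetric])
    also have "\<dots> = qform I' (\<lambda>x y. K (\<phi> x) (\<phi> y)) v"
      unfolding qform_def using assms(1) by (intro sum.cong refl) (simp add: bij_betw_inv_into_left)
    finally show ?thesis by simp
  qed
  then show ?thesis using assms(2) by (simp add: pos_kernel_def)
qed

lemma pos_kernel_partial_trace: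
  assumes "finite A" "pos_kernel (A \<times> Y) K"
  shows "pos_kernel Y (\<lambda>y y'. \<Sum>a\<in>A. K (a, y) (a, y'))"
proof -
  have "qform Y (\<lambda>y y'. \<Sum>a\<in>A. K (a, y) (a, y')) v
      = (\<Sum>a\<in>A. qform (A \<times> Y) K (\<lambda>x. of_bool (fst x = a) * v (snd x)))" for v
    by (rule sum_qform_slice[symmetric]) (simp_all add: assms)
  then show ?thesis using assms(2) by (simp add: pos_kernel_def sum_nonneg)
qed

text \<open>Polarization: the form is real on the two point vectors, which makes the diagonal
  entries real. Its reality on their sum and on their combination with coefficient
  \<open>\<i>\<close> then compares the imaginary and the real parts of \<open>K x y\<close> and
  \<open>K y x\<close>.\<close>

lemma pos_kernel_hermitian:
  assumes "pos_kernel I K" "finite I" "x \<in> I" "y \<in> I"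
  shows "K y x = cnj (K x y)"
proof -
  have sum_point: "(\<Sum>z\<in>I. h z * (of_bool (z = x) * c + of_bool (z = y) * c')) = h x * c + h y * c'"
    for h :: "'a \<Rightarrow> complex" and c c'
    using assms(2-4) by (simp add: algebra_simps sum.distrib of_bool_def if_distrib[of "\<lambda>c. _ * c"]
        if_distrib[of "\<lambda>c. c * _"] cong: if_cong)
  have qf: "qform I K (\<lambda>z. of_bool (z = x) * c + of_bool (z = y) * c')
      = (K x x * c + K x y * c') * cnj c + (K y x * c + K y y * c') * cnj c'" for c c'
  proof -
    let ?v = "\<lambda>z. of_bool (z = x) * c + of_bool (z = y) * c' :: complex"
    have "qform I K ?v = (\<Sum>z\<in>I. (\<Sum>z'\<in>I. K z z' * ?v z') * (of_bool (z = x) * cnj c + of_bool (z = y) * cnj c'))"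
      unfolding qform_def by (intro sum.cong refl) (simp add: sum_distrib_left mult_ac)
    then show ?thesis by (simp only: sum_point)
  qed
  have im: "Im (qform I K v) = 0" for v using assms(1) by (simp add: pos_kernel_def)
  show ?thesis
    using im[of "\<lambda>z. of_bool (z = x) * 1 + of_bool (z = y) * 0"]
      im[of "\<lambda>z. of_bool (z = x) * 0 + of_bool (z = y) * 1"]
      im[of "\<lambda>z. of_bool (z = x) * 1 + of_bool (z = y) * 1"]
      im[of "\<lambda>z. of_bool (z = x) * 1 + of_bool (z = y) * \<i>"]
    unfolding qf by (simp add: complex_eq_iff)
qed

lemma pos_kernel_eigenvalue_nonneg:
  assumes "pos_kernel I K" "diagonalizes I K N u p" "finite N" "k \<in> N"
  shows "p k \<ge> 0"
proof -
  have onb: "orthonormal_basis I N u" using assms(2) by (simp add: diagonalizes_def)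
  have "(\<Sum>l\<in>N. p l * (cmod (braket I (u l) (u k)))\<^sup>2) = (\<Sum>l\<in>N. if l = k then p l else 0)"
    using assms(4) by (intro sum.cong refl) (simp add: braket_self[OF onb])
  then have "qform I K (u k) = of_real (p k)"
    using qform_diagonalizes[OF assms(2), of "u k"] assms(3,4) by simp
  then show ?thesis using assms(1) by (metis Re_complex_of_real pos_kernel_def)
qed

section \<open>Mixed-radix encoding of multi-indices\<close>

lemma enc_cong: "(\<And>v. v \<in> set vs \<Longrightarrow> x v = y v) \<Longrightarrow> enc d vs x = enc d vs y"
  by (induction vs) auto

lemma enc_less:
  assumes "\<And>v. v \<in> set vs \<Longrightarrow> x v < d v"
  shows "enc d vs x < prod_list (map d vs)"
  using assms
proof (induction vs)
  case (Cons v vs)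
  let ?P = "prod_list (map d vs)"
  have "enc d (v # vs) x < x v * ?P + ?P" using Cons by simp
  also have "\<dots> = Suc (x v) * ?P" by simp
  also have "\<dots> \<le> d v * ?P" using Cons.prems[of v] by (intro mult_le_mono1) auto
  finally show ?case by simp
qed simp

lemma dec_enc:
  assumes "distinct vs" "\<And>v. v \<in> set vs \<Longrightarrow> x v < d v"
  shows "dec d vs (enc d vs x) = (\<lambda>v. if v \<in> set vs then x v else 0)"
  using assms
proof (induction vs)
  case (Cons v vs)
  let ?P = "prod_list (map d vs)"
  have less: "enc d vs x < ?P" using Cons.prems by (intro enc_less) auto
  then have "?P \<noteq> 0" by linarith
  from div_mult_self3[OF this, of "x v" "enc d vs x"] less
  have "(x v * ?P + enc d vs x) div ?P = x v" by (simp only: div_less add_0_right)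
  then show ?case using Cons less by (auto simp: fun_eq_iff)
qed simp

lemma dec_notin: "v \<notin> set vs \<Longrightarrow> dec d vs i v = 0"
  by (induction vs arbitrary: i) auto

lemma dec_less:
  assumes "i < prod_list (map d vs)" "distinct vs" "v \<in> set vs"
  shows "dec d vs i v < d v"
  using assms
proof (induction vs arbitrary: i)
  case (Cons w vs)
  let ?P = "prod_list (map d vs)"
  \<comment> \<open>The product \<open>?P\<close> is positive, since otherwise the bound on
    \<open>i\<close> would read \<open>i < 0\<close>.\<close>
  have "i mod ?P < ?P" using Cons.prems(1) by (intro mod_less_divisor) (auto intro: Nat.gr0I)
  moreover have "i div ?P < d w" using Cons.prems(1) by (simp add: less_mult_imp_div_less)
  ultimately show ?case using Cons by auto
qed simp

lemma enc_dec:
  assumes "i < prod_list (map d vs)" "distinct vs"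
  shows "enc d vs (dec d vs i) = i"
  using assms
proof (induction vs arbitrary: i)
  case (Cons w vs)
  let ?P = "prod_list (map d vs)"
  have "i mod ?P < ?P" using Cons.prems(1) by (intro mod_less_divisor) (auto intro: Nat.gr0I)
  then have "enc d vs (dec d vs (i mod ?P)) = i mod ?P" using Cons by simp
  moreover have "enc d vs ((dec d vs (i mod ?P))(w := i div ?P)) = enc d vs (dec d vs (i mod ?P))"
    using Cons.prems(2) by (intro enc_cong) auto
  ultimately show ?case by (simp only: dec.simps enc.simps fun_upd_same div_mult_mod_eq)
qed simp

section \<open>Marginals as kernels on multi-indices\<close>

text \<open>Multi-indices are 0 outside \<open>J\<close>, as \<open>dec\<close> produces them, so
  each has exactly one representative.\<close>

definition index_box :: "(party \<Rightarrow> nat) \<Rightarrow> party set \<Rightarrow> (party \<Rightarrow> nat) set" where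
  "index_box d J = {x. \<forall>v. (v \<in> J \<longrightarrow> x v < d v) \<and> (v \<notin> J \<longrightarrow> x v = 0)}"

text \<open>On boxes over disjoint sets addition glues two multi-indices, because each is 0 where
  the other lives.\<close>

definition index_join :: "(party \<Rightarrow> nat) \<Rightarrow> (party \<Rightarrow> nat) \<Rightarrow> party \<Rightarrow> nat" where
  "index_join x y = (\<lambda>v. x v + y v)"

lemma index_join_assoc: "index_join (index_join x y) z = index_join x (index_join y z)"
  and index_join_commute: "index_join x y = index_join y x"
  and index_join_left_commute: "index_join x (index_join y z) = index_join y (index_join x z)"
  by (auto simp: index_join_def)

lemma parties_distinct: "distinct parties" and set_parties: "set parties = UNIV"
  using party.exhaust by (auto simp: parties_def)

lemma distinct_plist: "distinct (plist J)" and set_plist: "set (plist J) = J"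
  by (simp_all add: plist_def parties_distinct set_parties)

lemma plist_UNIV: "plist UNIV = parties"
  by (simp add: plist_def)

lemma bij_betw_dec: "bij_betw (dec d (plist J)) {..<sdim d J} (index_box d J)"
proof (rule bij_betwI[where g = "enc d (plist J)"])
  show "dec d (plist J) \<in> {..<sdim d J} \<rightarrow> index_box d J"
    by (auto simp: index_box_def sdim_def set_plist distinct_plist intro!: dec_less dec_notin)
  show "enc d (plist J) \<in> index_box d J \<rightarrow> {..<sdim d J}"
    by (auto simp: index_box_def sdim_def set_plist intro!: enc_less)
  show "enc d (plist J) (dec d (plist J) i) = i" if "i \<in> {..<sdim d J}" for i
    using that by (simp add: enc_dec distinct_plist sdim_def)
  show "dec d (plist J) (enc d (plist J) x) = x" if "x \<in> index_box d J" for x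
    using that by (subst dec_enc) (auto simp: index_box_def set_plist distinct_plist fun_eq_iff)
qed

lemma dec_enc_box: "x \<in> index_box d J \<Longrightarrow> dec d (plist J) (enc d (plist J) x) = x"
  by (subst dec_enc) (auto simp: index_box_def set_plist distinct_plist fun_eq_iff)

lemma bij_betw_enc: "bij_betw (enc d (plist J)) (index_box d J) {..<sdim d J}"
  by (rule bij_betw_byWitness[where f' = "dec d (plist J)"])
    (auto simp: dec_enc_box enc_dec distinct_plist sdim_def index_box_def set_plist
      intro!: enc_less dec_less dec_notin)

lemma finite_box: "finite (index_box d J)"
  using bij_betw_finite[OF bij_betw_dec] by blast

lemma bij_betw_join:
  assumes "J \<inter> J' = {}"
  shows "bij_betw (\<lambda>(x, z). index_join x z) (index_box d J \<times> index_box d J') (index_box d (J \<union> J'))"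
proof -
  have "v \<notin> J'" if "v \<in> J" for v using assms that by auto
  moreover have "v \<notin> J" if "v \<in> J'" for v using assms that by auto
  ultimately show ?thesis
    by (intro bij_betwI[where g = "\<lambda>u. (\<lambda>v. if v \<in> J then u v else 0, \<lambda>v. if v \<in> J' then u v else 0)"])
      (auto simp: index_box_def index_join_def fun_eq_iff)
qed

lemma sum_box_Un:
  assumes "J \<inter> J' = {}"
  shows "(\<Sum>u\<in>index_box d (J \<union> J'). h u) = (\<Sum>x\<in>index_box d J. \<Sum>z\<in>index_box d J'. h (index_join x z))"
  by (subst sum.reindex_bij_betw[OF bij_betw_join[OF assms], symmetric])
    (simp add: sum_Times case_prod_unfold)

text \<open>The reduced state indexed by multi-indices instead of encoded numbers; tracing out
  further parties is then a sum over another box.\<close>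

definition marginal :: "(party \<Rightarrow> nat) \<Rightarrow> complex mat \<Rightarrow> party set \<Rightarrow>
    (party \<Rightarrow> nat) \<Rightarrow> (party \<Rightarrow> nat) \<Rightarrow> complex" where
  "marginal d \<rho> J x y =
     (\<Sum>z\<in>index_box d (- J). \<rho> $$ (enc d parties (index_join x z), enc d parties (index_join y z)))"

lemma marginal_partial_trace:
  assumes "J \<inter> J' = {}"
  shows "marginal d \<rho> J x y = (\<Sum>z\<in>index_box d J'. marginal d \<rho> (J \<union> J') (index_join x z) (index_join y z))"
proof -
  have "- J = J' \<union> - (J \<union> J')" "J' \<inter> - (J \<union> J') = {}" using assms by auto
  then show ?thesis unfolding marginal_def by (simp only: sum_box_Un index_join_assoc)
qed

text \<open>Each full index is split into its parts on \<open>J\<close> and on the complement. The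
  conditions in \<open>reduced_state\<close> fix the two parts on \<open>J\<close> to be
  \<open>x\<close> and \<open>y\<close> and identify the two complementary parts, so a single sum
  remains.\<close>

lemma reduced_state_marginal:
  assumes "x \<in> index_box d J" "y \<in> index_box d J"
  shows "reduced_state d \<rho> J $$ (enc d (plist J) x, enc d (plist J) y) = marginal d \<rho> J x y"
proof -
  have bij: "bij_betw (enc d parties) (index_box d UNIV) {..<sdim d UNIV}"
    using bij_betw_enc[of d UNIV] by (simp add: plist_UNIV)
  have less: "enc d (plist J) x < sdim d J" if "x \<in> index_box d J" for x
    using bij_betw_enc[of d J] that by (auto simp: bij_betw_def)
  have dec: "dec d parties (enc d parties u) = u" if "u \<in> index_box d UNIV" for u
    using dec_enc_box[OF that] by (simp add: plist_UNIV)
  have join_UNIV: "index_join x z \<in> index_box d UNIV" if "x \<in> index_box d J" "z \<in> index_box d (- J)" for x z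
    using that by (auto simp: index_box_def index_join_def) (metis add.commute add.right_neutral)+
  have enc_join: "enc d (plist J) (index_join x' z) = enc d (plist J) x \<longleftrightarrow> x' = x"
    if "x' \<in> index_box d J" "x \<in> index_box d J" "z \<in> index_box d (- J)" for x x' z
  proof -
    have "enc d (plist J) (index_join x' z) = enc d (plist J) x'"
      using that by (intro enc_cong) (auto simp: index_join_def index_box_def set_plist)
    then show ?thesis using that bij_betw_enc[of d J] by (auto simp: bij_betw_def inj_on_def)
  qed
  have agree: "(\<forall>v. v \<notin> J \<longrightarrow> index_join x' z v = index_join y' z' v) \<longleftrightarrow> z' = z"
    if "x' \<in> index_box d J" "y' \<in> index_box d J" "z \<in> index_box d (- J)" "z' \<in> index_box d (- J)" for x' y' z z'
    using that by (auto simp: index_join_def index_box_def fun_eq_iff) metis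
  have split_UNIV: "(\<Sum>u\<in>index_box d UNIV. h u) = (\<Sum>x\<in>index_box d J. \<Sum>z\<in>index_box d (- J). h (index_join x z))"
    for h :: "(party \<Rightarrow> nat) \<Rightarrow> complex"
    using sum_box_Un[of J "- J" h d] by simp
  let ?r = "\<lambda>u w. \<rho> $$ (enc d parties u, enc d parties w)"
  have "reduced_state d \<rho> J $$ (enc d (plist J) x, enc d (plist J) y)
      = (\<Sum>i<sdim d UNIV. \<Sum>j<sdim d UNIV.
       if enc d (plist J) (dec d parties i) = enc d (plist J) x \<and> enc d (plist J) (dec d parties j) = enc d (plist J) y
          \<and> (\<forall>v. v \<notin> J \<longrightarrow> dec d parties i v = dec d parties j v)
       then \<rho> $$ (i, j) else 0)"
    by (simp add: reduced_state_def less assms)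
  also have "\<dots> = (\<Sum>u\<in>index_box d UNIV. \<Sum>w\<in>index_box d UNIV.
       if enc d (plist J) u = enc d (plist J) x \<and> enc d (plist J) w = enc d (plist J) y
          \<and> (\<forall>v. v \<notin> J \<longrightarrow> u v = w v)
       then ?r u w else 0)"
    unfolding sum.reindex_bij_betw[OF bij, symmetric] by (intro sum.cong refl) (simp add: dec)
  also have "\<dots> = (\<Sum>x'\<in>index_box d J. \<Sum>z\<in>index_box d (- J). \<Sum>y'\<in>index_box d J. \<Sum>z'\<in>index_box d (- J).
       if enc d (plist J) (index_join x' z) = enc d (plist J) x \<and> enc d (plist J) (index_join y' z') = enc d (plist J) y
          \<and> (\<forall>v. v \<notin> J \<longrightarrow> index_join x' z v = index_join y' z' v)
       then ?r (index_join x' z) (index_join y' z') else 0)"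
    by (simp only: split_UNIV)
  also have "\<dots> = (\<Sum>x'\<in>index_box d J. \<Sum>z\<in>index_box d (- J). \<Sum>y'\<in>index_box d J. \<Sum>z'\<in>index_box d (- J).
       if z' = z then (if y' = y then (if x' = x then ?r (index_join x' z) (index_join y' z') else 0) else 0) else 0)"
    by (intro sum.cong refl) (simp add: enc_join agree assms)
  also have "\<dots> = (\<Sum>x'\<in>index_box d J. \<Sum>z\<in>index_box d (- J). if x' = x then ?r (index_join x' z) (index_join y z) else 0)"
    using assms by (intro sum.cong refl) (simp add: finite_box)
  also have "\<dots> = (\<Sum>z\<in>index_box d (- J). \<Sum>x'\<in>index_box d J. if x' = x then ?r (index_join x' z) (index_join y z) else 0)"
    by (rule sum.swap)
  also have "\<dots> = marginal d \<rho> J x y"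
    using assms by (simp add: marginal_def finite_box)
  finally show ?thesis .
qed

lemma psd_pos_kernel:
  assumes "psd M" "M \<in> carrier_mat n n"
  shows "pos_kernel {..<n} (\<lambda>i j. M $$ (i, j))"
proof -
  have "qform {..<n} (\<lambda>i j. M $$ (i, j)) v = (M *\<^sub>v Matrix.vec n v) \<bullet>c Matrix.vec n v" for v
    using assms(2)
    by (simp add: qform_def scalar_prod_def lessThan_atLeast0[symmetric] sum_distrib_left mult_ac)
  then show ?thesis using assms by (simp add: pos_kernel_def psd_def)
qed

text \<open>The full index set is factored with the complement of \<open>J\<close> in front, since
  partial traces are taken over the first factor.\<close>

lemma marginal_pos_kernel:
  assumes "density_matrix d \<rho>"
  shows "pos_kernel (index_box d J) (marginal d \<rho> J)"
proof -
  have "bij_betw (\<lambda>(z, x). index_join z x) (index_box d (- J) \<times> index_box d J) (index_box d UNIV)"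
    using bij_betw_join[of "- J" J d] by simp
  moreover have "bij_betw (enc d parties) (index_box d UNIV) {..<sdim d UNIV}"
    using bij_betw_enc[of d UNIV] by (simp add: plist_UNIV)
  ultimately have "bij_betw (enc d parties \<circ> (\<lambda>(z, x). index_join z x))
      (index_box d (- J) \<times> index_box d J) {..<sdim d UNIV}" by (rule bij_betw_trans)
  moreover have "pos_kernel {..<sdim d UNIV} (\<lambda>i j. \<rho> $$ (i, j))"
    using assms by (simp add: density_matrix_def psd_pos_kernel)
  ultimately have "pos_kernel (index_box d (- J) \<times> index_box d J)
      (\<lambda>x y. \<rho> $$ ((enc d parties \<circ> (\<lambda>(z, x). index_join z x)) x, (enc d parties \<circ> (\<lambda>(z, x). index_join z x)) y))"
    by (rule pos_kernel_reindex)
  from pos_kernel_partial_trace[OF finite_box this] show ?thesis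
    by (rule pos_kernel_cong) (simp add: marginal_def index_join_commute)
qed

lemma marginal_trace:
  assumes "density_matrix d \<rho>"
  shows "(\<Sum>x\<in>index_box d J. marginal d \<rho> J x x) = 1"
proof -
  have bij: "bij_betw (enc d parties) (index_box d UNIV) {..<sdim d UNIV}"
    using bij_betw_enc[of d UNIV] by (simp add: plist_UNIV)
  have "(\<Sum>x\<in>index_box d J. marginal d \<rho> J x x)
      = (\<Sum>u\<in>index_box d (J \<union> - J). \<rho> $$ (enc d parties u, enc d parties u))"
    unfolding marginal_def by (rule sum_box_Un[symmetric]) simp
  also have "\<dots> = (\<Sum>i<sdim d UNIV. \<rho> $$ (i, i))"
    using sum.reindex_bij_betw[OF bij, of "\<lambda>i. \<rho> $$ (i, i)"] by simp
  also have "\<dots> = 1" using assms by (auto simp: density_matrix_def mtrace_def)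
  finally show ?thesis .
qed

text \<open>The reduced matrix is diagonalized and its eigenvectors are transported along
  \<open>enc\<close>. One list of eigenvalues thereby serves both the kernel inequalities and all
  trace functions of the matrix.\<close>

theorem marginal_spectrum:
  assumes "density_matrix d \<rho>"
  obtains u p where "diagonalizes (index_box d J) (marginal d \<rho> J) {..<sdim d J} u p"
    and "\<And>k. k < sdim d J \<Longrightarrow> p k \<ge> 0" and "(\<Sum>k<sdim d J. p k) = 1"
    and "\<And>f. tr_fun f (reduced_state d \<rho> J) = (\<Sum>k<sdim d J. f (p k))"
proof -
  let ?M = "reduced_state d \<rho> J" and ?n = "sdim d J"
  have M: "?M \<in> carrier_mat ?n ?n" by (simp add: reduced_state_def)
  have M_eq: "?M $$ (k, l) = marginal d \<rho> J (dec d (plist J) k) (dec d (plist J) l)"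
    if "k < ?n" "l < ?n" for k l
  proof -
    have "dec d (plist J) k \<in> index_box d J" "dec d (plist J) l \<in> index_box d J"
      using bij_betw_dec[of d J] that by (auto simp: bij_betw_def)
    from reduced_state_marginal[OF this, of \<rho>] show ?thesis
      using that by (simp add: enc_dec distinct_plist sdim_def)
  qed
  have pos: "pos_kernel {..<?n} (\<lambda>k l. ?M $$ (k, l))"
    by (rule pos_kernel_cong[OF pos_kernel_reindex[OF bij_betw_dec marginal_pos_kernel[OF assms]]])
      (simp add: M_eq)
  obtain u p where up: "diagonalizes {..<?n} (\<lambda>k l. ?M $$ (k, l)) {..<?n} u p"
    using hermitian_diagonalizes[of ?n "\<lambda>k l. ?M $$ (k, l)", OF pos_kernel_hermitian[OF pos]] by auto
  have diag: "diagonalizes (index_box d J) (marginal d \<rho> J) {..<?n} (\<lambda>k x. u k (enc d (plist J) x)) p"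
    using diagonalizes_reindex[OF bij_betw_enc up] by (simp add: diagonalizes_def reduced_state_marginal)
  show ?thesis
  proof (rule that[OF diag])
    show "p k \<ge> 0" if "k < ?n" for k
      using pos_kernel_eigenvalue_nonneg[OF pos up] that by simp
    show "(\<Sum>k<?n. p k) = 1"
      using trace_diagonalizes[OF diag] marginal_trace[OF assms, of J]
      by (metis of_real_eq_1_iff)
    show "tr_fun f ?M = (\<Sum>k<?n. f (p k))" for f by (rule tr_fun_diagonalizes[OF M up])
  qed
qed

section \<open>Entropies of marginals\<close>

lemma vn_entropy_eq:
  assumes "\<And>f. tr_fun f (reduced_state d \<rho> J) = (\<Sum>k<n. f (p k))" "\<And>k. k < n \<Longrightarrow> p k \<ge> 0"
  shows "vn_entropy d \<rho> J = - (\<Sum>k<n. p k * ln (p k))"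
  unfolding vn_entropy_def assms(1) using assms(2) by (auto intro!: sum.cong simp: order.antisym)

text \<open>\<open>strong_subadditivity_kernel\<close> transported along the gluing of
  multi-indices. \<open>A\<close>, \<open>B\<close> and \<open>R\<close> are sets of parties, so a
  trivial system is the empty set.\<close>

theorem strong_subadditivity:
  assumes dm: "density_matrix d \<rho>" and disj: "A \<inter> B = {}" "A \<inter> R = {}" "B \<inter> R = {}"
  shows "vn_entropy d \<rho> R + vn_entropy d \<rho> (A \<union> B \<union> R) \<le> vn_entropy d \<rho> (A \<union> R) + vn_entropy d \<rho> (B \<union> R)"
proof -
  obtain e p where e: "diagonalizes (index_box d (A \<union> (B \<union> R))) (marginal d \<rho> (A \<union> (B \<union> R))) {..<sdim d (A \<union> (B \<union> R))} e p"
    and p: "\<And>k. k < sdim d (A \<union> (B \<union> R)) \<Longrightarrow> p k \<ge> 0"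
    and ep: "\<And>f. tr_fun f (reduced_state d \<rho> (A \<union> (B \<union> R))) = (\<Sum>k<sdim d (A \<union> (B \<union> R)). f (p k))"
    using marginal_spectrum[OF dm] by metis
  obtain f q where f: "diagonalizes (index_box d (A \<union> R)) (marginal d \<rho> (A \<union> R)) {..<sdim d (A \<union> R)} f q"
    and q: "\<And>k. k < sdim d (A \<union> R) \<Longrightarrow> q k \<ge> 0"
    and fq: "\<And>f. tr_fun f (reduced_state d \<rho> (A \<union> R)) = (\<Sum>k<sdim d (A \<union> R). f (q k))"
    using marginal_spectrum[OF dm] by metis
  obtain e' p' where e': "diagonalizes (index_box d (B \<union> R)) (marginal d \<rho> (B \<union> R)) {..<sdim d (B \<union> R)} e' p'"
    and p': "\<And>k. k < sdim d (B \<union> R) \<Longrightarrow> p' k \<ge> 0"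
    and ep': "\<And>f. tr_fun f (reduced_state d \<rho> (B \<union> R)) = (\<Sum>k<sdim d (B \<union> R). f (p' k))"
    using marginal_spectrum[OF dm] by metis
  obtain f' q' where f': "diagonalizes (index_box d R) (marginal d \<rho> R) {..<sdim d R} f' q'"
    and q': "\<And>k. k < sdim d R \<Longrightarrow> q' k \<ge> 0"
    and fq': "\<And>f. tr_fun f (reduced_state d \<rho> R) = (\<Sum>k<sdim d R. f (q' k))"
    using marginal_spectrum[OF dm] by metis
  \<comment> \<open>\<open>j\<close> and \<open>j3\<close> identify products of two and of three
    boxes with the box over the union.\<close>
  define j where "j = (\<lambda>(x, z). index_join x z)"
  define j3 where "j3 = (\<lambda>(a, x). index_join a (j x))"
  have jAR: "bij_betw j (index_box d A \<times> index_box d R) (index_box d (A \<union> R))"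
    and jBR: "bij_betw j (index_box d B \<times> index_box d R) (index_box d (B \<union> R))"
    unfolding j_def using disj by (simp_all add: bij_betw_join)
  have "bij_betw (map_prod id j) (index_box d A \<times> index_box d B \<times> index_box d R) (index_box d A \<times> index_box d (B \<union> R))"
    by (intro bij_betw_map_prod jBR) simp
  moreover have "bij_betw j (index_box d A \<times> index_box d (B \<union> R)) (index_box d (A \<union> (B \<union> R)))"
    unfolding j_def using disj by (intro bij_betw_join) auto
  ultimately have "bij_betw (j \<circ> map_prod id j) (index_box d A \<times> index_box d B \<times> index_box d R) (index_box d (A \<union> (B \<union> R)))"
    by (rule bij_betw_trans)
  moreover have "j \<circ> map_prod id j = j3" by (auto simp: fun_eq_iff j_def j3_def)
  ultimately have jABR: "bij_betw j3 (index_box d A \<times> index_box d B \<times> index_box d R) (index_box d (A \<union> (B \<union> R)))"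
    by simp
  have "(\<Sum>k<sdim d (B \<union> R). p' k * ln (p' k)) - (\<Sum>k<sdim d R. q' k * ln (q' k))
      \<le> (\<Sum>k<sdim d (A \<union> (B \<union> R)). p k * ln (p k)) - (\<Sum>k<sdim d (A \<union> R). q k * ln (q k))"
  proof (rule strong_subadditivity_kernel[OF diagonalizes_reindex[OF jABR e] diagonalizes_reindex[OF jAR f]
        diagonalizes_reindex[OF jBR e'] f'])
    fix a r a' r'
    have "(A \<union> R) \<inter> B = {}" "A \<union> R \<union> B = A \<union> (B \<union> R)" using disj by auto
    from marginal_partial_trace[OF this(1), of d \<rho> "j (a, r)" "j (a', r')", unfolded this(2)]
    show "marginal d \<rho> (A \<union> R) (j (a, r)) (j (a', r'))
        = (\<Sum>b\<in>index_box d B. marginal d \<rho> (A \<union> (B \<union> R)) (j3 (a, b, r)) (j3 (a', b, r')))"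
      by (simp add: j_def j3_def index_join_assoc index_join_commute index_join_left_commute)
  next
    fix x y
    have "(B \<union> R) \<inter> A = {}" "B \<union> R \<union> A = A \<union> (B \<union> R)" using disj by auto
    from marginal_partial_trace[OF this(1), of d \<rho> "j x" "j y", unfolded this(2)]
    show "marginal d \<rho> (B \<union> R) (j x) (j y)
        = (\<Sum>a\<in>index_box d A. marginal d \<rho> (A \<union> (B \<union> R)) (j3 (a, x)) (j3 (a, y)))"
      by (simp add: j3_def index_join_commute)
  next
    fix r r'
    have "R \<inter> B = {}" "R \<union> B = B \<union> R" using disj by auto
    from marginal_partial_trace[OF this(1), of d \<rho> r r', unfolded this(2)]
    show "marginal d \<rho> R r r' = (\<Sum>b\<in>index_box d B. marginal d \<rho> (B \<union> R) (j (b, r)) (j (b, r')))"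
      by (simp add: j_def index_join_commute)
  qed (simp_all add: finite_box p p')
  then show ?thesis
    by (simp add: vn_entropy_eq[OF ep p] vn_entropy_eq[OF fq q] vn_entropy_eq[OF ep' p'] vn_entropy_eq[OF fq' q'] Un_assoc)
qed

text \<open>The empty tensor product has dimension 1, and its only eigenvalue is the trace
  1.\<close>

lemma vn_entropy_empty:
  assumes "density_matrix d \<rho>"
  shows "vn_entropy d \<rho> {} = 0"
proof -
  have "sdim d {} = 1" by (simp add: sdim_def plist_def)
  moreover obtain p where p: "\<And>k. k < sdim d {} \<Longrightarrow> p k \<ge> 0" and sum1: "(\<Sum>k<sdim d {}. p k) = 1"
    and tr: "\<And>f. tr_fun f (reduced_state d \<rho> {}) = (\<Sum>k<sdim d {}. f (p k))"
    using marginal_spectrum[OF assms, of "{}"] by metis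
  ultimately show ?thesis by (simp add: vn_entropy_eq[OF tr p])
qed

corollary subadditivity:
  assumes "density_matrix d \<rho>" "A \<inter> B = {}"
  shows "vn_entropy d \<rho> (A \<union> B) \<le> vn_entropy d \<rho> A + vn_entropy d \<rho> B"
  using strong_subadditivity[OF assms(1), of A B "{}"] assms by (simp add: vn_entropy_empty)

text \<open>As the eigenvalues sum to 1, the constant 1 can be distributed over them. Each term is
  then minus the difference quotient at 1 of the map from \<open>q\<close> to
  \<open>p k powr q\<close>, whose derivative there is \<open>p k * ln (p k)\<close>; an eigenvalue
  0 contributes 0 throughout.\<close>

lemma tsallis_tendsto_vn_entropy:
  assumes "density_matrix d \<rho>"
  shows "((\<lambda>q. tsallis q d \<rho> J) \<longlongrightarrow> vn_entropy d \<rho> J) (at_right 1)"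
proof -
  obtain p where p: "\<And>k. k < sdim d J \<Longrightarrow> p k \<ge> 0" and sum1: "(\<Sum>k<sdim d J. p k) = 1"
    and tr: "\<And>f. tr_fun f (reduced_state d \<rho> J) = (\<Sum>k<sdim d J. f (p k))"
    using marginal_spectrum[OF assms, of J] by metis
  have "((\<lambda>q. \<Sum>k<sdim d J. (p k powr q - p k) / (1 - q)) \<longlongrightarrow> (\<Sum>k<sdim d J. - (p k * ln (p k)))) (at_right 1)"
  proof (intro tendsto_sum)
    fix k assume "k \<in> {..<sdim d J}"
    then consider "p k = 0" | "p k > 0" using p[of k] by force
    then show "((\<lambda>q. (p k powr q - p k) / (1 - q)) \<longlongrightarrow> - (p k * ln (p k))) (at_right 1)"
    proof cases
      case 2
      then show ?thesis by real_asymp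
    qed simp
  qed
  moreover have "(\<Sum>k<sdim d J. (p k powr q - p k) / (1 - q)) = tsallis q d \<rho> J" for q
    by (simp add: tsallis_def tr sum_divide_distrib[symmetric] sum_subtractf sum1)
  ultimately show ?thesis by (simp add: vn_entropy_eq[OF tr p] sum_negf)
qed

subsection \<open>Relative homology of the filtration\<close>

lemma betti_relI: "card (rel_hom K L k) = 2 ^ n \<Longrightarrow> betti_rel K L k = n"
  unfolding betti_rel_def by (rule the_equality) auto

text \<open>The only class is that of the zero chain, whatever the boundaries are. This covers
  families not closed under faces, where a boundary may fail to be a cycle.\<close>

lemma betti_rel_no_cycles:
  assumes "rel_cycles K L k = {{}}"
  shows "betti_rel K L k = 0"
  by (rule betti_relI) (simp add: rel_hom_def assms)

lemma symdiff_empty [simp]: "symdiff {} b = b" "symdiff a {} = a"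
  and symdiff_self [simp]: "symdiff a a = {}"
  by (auto simp: symdiff_def)

lemma betti_rel_no_boundaries:
  assumes "rel_boundaries K L k = {{}}" "card (rel_cycles K L k) = 2 ^ n"
  shows "betti_rel K L k = n"
proof (rule betti_relI)
  have "rel_hom K L k = (\<lambda>c. {c}) ` rel_cycles K L k" by (simp add: rel_hom_def assms(1))
  then show "card (rel_hom K L k) = 2 ^ n" by (simp add: card_image assms(2))
qed

lemma betti_rel_single_class:
  assumes "rel_cycles K L k = {{}, c}" "rel_boundaries K L k = {{}, c}"
  shows "betti_rel K L k = 0"
proof (rule betti_relI)
  have "rel_hom K L k = {{{}, c}}" by (auto simp: rel_hom_def assms)
  then show "card (rel_hom K L k) = 2 ^ 0" by simp
qed

lemma rel_bd_empty [simp]: "rel_bd K L {} = {}"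
  by (simp add: rel_bd_def)

lemma rel_bd_singleton:
  "rel_bd K L {\<sigma>} = {\<tau> \<in> K - L. \<tau> \<subseteq> \<sigma> \<and> card \<sigma> = Suc (card \<tau>)}"
proof -
  have "{\<sigma>' \<in> {\<sigma>}. P \<sigma>'} = (if P \<sigma> then {\<sigma>} else {})" for P by auto
  then show ?thesis by (auto simp: rel_bd_def)
qed

text \<open>With \<open>r = {R}\<close>, \<open>x = {A, R}\<close>, \<open>y = {B, R}\<close>, \<open>z = {A, B, R}\<close>, the chains of \<open>K\<close> relative to \<open>L\<close> are
spanned by \<open>S\<close>. \<open>S\<close> need not be closed under taking faces that contain \<open>r\<close>.\<close>

locale relative_cone =
  fixes K L S :: "'a set set" and r x y z :: "'a set"
  assumes KL: "K - L = S" and S_sub: "S \<subseteq> {r, x, y, z}" and vertex: "r \<in> S"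
    and cards: "card r = 1" "card x = 2" "card y = 2" "card z = 3"
    and faces: "r \<subseteq> x" "r \<subseteq> y" "x \<subseteq> z" "y \<subseteq> z" and xy: "x \<noteq> y"
begin

lemma S_cases: "\<sigma> \<in> S \<Longrightarrow> \<sigma> = r \<or> \<sigma> = x \<or> \<sigma> = y \<or> \<sigma> = z"
  using S_sub by auto

lemma ksimp_0: "ksimp S 0 = {r}"
  and ksimp_1: "ksimp S 1 = S \<inter> {x, y}"
  and ksimp_2: "ksimp S 2 = S \<inter> {z}"
  and ksimp_ge_3: "k \<ge> 3 \<Longrightarrow> ksimp S k = {}"
  unfolding ksimp_def using vertex cards by (auto dest: S_cases)

lemma rel_bd_vertex: "rel_bd K L {r} = {}"
  and rel_bd_edge: "rel_bd K L {x} = {r}" "rel_bd K L {y} = {r}"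
  and rel_bd_triangle: "rel_bd K L {z} = S \<inter> {x, y}"
  unfolding rel_bd_singleton KL using vertex cards faces by (auto dest: S_cases)

text \<open>\<open>r\<close> is a face of both edges and cancels modulo 2; every other member of
  \<open>S\<close> is too large to be a facet of an edge.\<close>

lemma rel_bd_edges: "rel_bd K L {x, y} = {}"
proof -
  have "even (card {\<sigma> \<in> {x, y}. \<tau> \<subseteq> \<sigma> \<and> card \<sigma> = Suc (card \<tau>)})" if "\<tau> \<in> S" for \<tau>
  proof (cases "\<tau> = r")
    case True
    then have "{\<sigma> \<in> {x, y}. \<tau> \<subseteq> \<sigma> \<and> card \<sigma> = Suc (card \<tau>)} = {x, y}"
      using cards faces by auto
    then show ?thesis using xy by simp
  next
    case False
    then have "card \<tau> \<ge> 2" using S_cases[OF that] cards by auto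
    then have "{\<sigma> \<in> {x, y}. \<tau> \<subseteq> \<sigma> \<and> card \<sigma> = Suc (card \<tau>)} = {}"
      using cards by auto
    then show ?thesis by (simp only: card.empty even_zero)
  qed
  then show ?thesis unfolding rel_bd_def KL by blast
qed

lemma rel_cycles_0: "rel_cycles K L 0 = {{}, {r}}"
  unfolding rel_cycles_def KL ksimp_0 by (auto simp: subset_singleton_iff rel_bd_vertex)

lemma rel_boundaries_0: "rel_boundaries K L 0 = (if x \<in> S \<or> y \<in> S then {{}, {r}} else {{}})"
proof -
  have *: "rel_boundaries K L 0 = rel_bd K L ` Pow (S \<inter> {x, y})"
    unfolding rel_boundaries_def KL using ksimp_1 by simp
  consider "x \<in> S" "y \<in> S" | "x \<in> S" "y \<notin> S" | "x \<notin> S" "y \<in> S" | "x \<notin> S" "y \<notin> S" by blast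
  then show ?thesis
  proof cases
    case 1
    then have "S \<inter> {x, y} = {x, y}" by auto
    then show ?thesis using 1 by (auto simp: * Pow_insert rel_bd_edge rel_bd_edges)
  next
    case 2
    then have "S \<inter> {x, y} = {x}" by auto
    then show ?thesis using 2 by (auto simp: * Pow_insert rel_bd_edge)
  next
    case 3
    then have "S \<inter> {x, y} = {y}" by auto
    then show ?thesis using 3 by (auto simp: * Pow_insert rel_bd_edge)
  next
    case 4
    then have "S \<inter> {x, y} = {}" by auto
    then show ?thesis using 4 by (simp add: *)
  qed
qed

text \<open>The class of the vertex \<open>r\<close> dies as soon as one of the two edges is
  present.\<close>

lemma betti_rel_0: "betti_rel K L 0 = (if x \<in> S \<or> y \<in> S then 0 else 1)"
proof (cases "x \<in> S \<or> y \<in> S")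
  case True
  then show ?thesis using betti_rel_single_class[OF rel_cycles_0] rel_boundaries_0 by simp
next
  case False
  moreover have "card (rel_cycles K L 0) = 2 ^ 1" by (simp add: rel_cycles_0)
  ultimately show ?thesis using betti_rel_no_boundaries rel_boundaries_0 by metis
qed

lemma rel_cycles_1: "rel_cycles K L 1 = (if x \<in> S \<and> y \<in> S then {{}, {x, y}} else {{}})"
proof -
  have "c \<subseteq> S \<inter> {x, y} \<and> rel_bd K L c = {} \<longleftrightarrow> c = {} \<or> c = {x, y} \<and> x \<in> S \<and> y \<in> S" for c
  proof
    assume *: "c \<subseteq> S \<inter> {x, y} \<and> rel_bd K L c = {}"
    then have "c = {} \<or> c = {x} \<or> c = {y} \<or> c = {x, y}" by blast
    then show "c = {} \<or> c = {x, y} \<and> x \<in> S \<and> y \<in> S"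
      using * rel_bd_edge by (elim disjE) auto
  next
    assume "c = {} \<or> c = {x, y} \<and> x \<in> S \<and> y \<in> S"
    then show "c \<subseteq> S \<inter> {x, y} \<and> rel_bd K L c = {}"
      using rel_bd_edges by (elim disjE) auto
  qed
  then show ?thesis unfolding rel_cycles_def KL ksimp_1 by (cases "x \<in> S \<and> y \<in> S") auto
qed

lemma rel_boundaries_1: "rel_boundaries K L 1 = (if z \<in> S then {{}, S \<inter> {x, y}} else {{}})"
proof -
  have *: "rel_boundaries K L 1 = rel_bd K L ` Pow (S \<inter> {z})"
    unfolding rel_boundaries_def KL using ksimp_2 by (simp add: numeral_2_eq_2)
  show ?thesis
  proof (cases "z \<in> S")
    case True
    then have "S \<inter> {z} = {z}" by auto
    then show ?thesis using True unfolding * by (simp add: Pow_insert rel_bd_triangle insert_commute)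
  next
    case False
    then have "S \<inter> {z} = {}" by auto
    then show ?thesis using False unfolding * by simp
  qed
qed

text \<open>The path formed by both edges is closed relative to \<open>L\<close>, and it bounds
  exactly when the triangle is present.\<close>

lemma betti_rel_1: "betti_rel K L 1 = (if x \<in> S \<and> y \<in> S \<and> z \<notin> S then 1 else 0)"
proof (cases "x \<in> S \<and> y \<in> S")
  case False
  then have "rel_cycles K L 1 = {{}}" using rel_cycles_1 by metis
  then have "betti_rel K L 1 = 0" by (rule betti_rel_no_cycles)
  then show ?thesis using False by metis
next
  case True
  then have cyc: "rel_cycles K L 1 = {{}, {x, y}}" using rel_cycles_1 by metis
  show ?thesis
  proof (cases "z \<in> S")
    case z: True
    have "S \<inter> {x, y} = {x, y}" using True by auto
    then have "rel_boundaries K L 1 = {{}, {x, y}}" using rel_boundaries_1 z by metis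
    then have "betti_rel K L 1 = 0" by (rule betti_rel_single_class[OF cyc])
    then show ?thesis using z by metis
  next
    case z: False
    then have "rel_boundaries K L 1 = {{}}" using rel_boundaries_1 by metis
    moreover have "card (rel_cycles K L 1) = 2 ^ 1" unfolding cyc by simp
    ultimately have "betti_rel K L 1 = 1" by (rule betti_rel_no_boundaries)
    then show ?thesis using z True by metis
  qed
qed

text \<open>The triangle is a relative cycle only when both edges are missing, a case that can occur
  because \<open>S\<close> need not be closed under faces.\<close>

lemma betti_rel_2: "betti_rel K L 2 = (if z \<in> S \<and> x \<notin> S \<and> y \<notin> S then 1 else 0)"
proof -
  have bdr: "rel_boundaries K L 2 = {{}}" unfolding rel_boundaries_def KL by (simp add: ksimp_ge_3)
  have "rel_cycles K L 2 = (if z \<in> S \<and> x \<notin> S \<and> y \<notin> S then {{}, {z}} else {{}})"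
    unfolding rel_cycles_def KL ksimp_2 by (auto simp: rel_bd_triangle subset_singleton_iff)
  then show ?thesis by (intro betti_rel_no_boundaries[OF bdr]) auto
qed

lemma betti_rel_ge_3: "k \<ge> 3 \<Longrightarrow> betti_rel K L k = 0"
  by (rule betti_rel_no_cycles) (auto simp: rel_cycles_def KL ksimp_ge_3)

end

section \<open>The integrated Euler characteristic\<close>

lemma set_with_PR:
  assumes "PR \<in> J"
  shows "J = {PR} \<or> J = {PA, PR} \<or> J = {PB, PR} \<or> J = {PA, PB, PR}"
proof -
  have *: "J = X" if "PA \<in> J \<longleftrightarrow> PA \<in> X" "PB \<in> J \<longleftrightarrow> PB \<in> X" "PR \<in> X" for X
  proof (rule Set.set_eqI)
    fix v show "v \<in> J \<longleftrightarrow> v \<in> X" using assms that by (cases v) simp_all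
  qed
  show ?thesis
    using *[of "{PR}"] *[of "{PA, PR}"] *[of "{PB, PR}"] *[of "{PA, PB, PR}"]
    by (cases "PA \<in> J"; cases "PB \<in> J") simp_all
qed

text \<open>Intervals are half-open because a simplex is present from its own correlation value on;
  the missing endpoint is negligible, and \<open>max\<close> covers an empty interval.\<close>

lemma integral_indicator_Ico:
  fixes l h :: real
  assumes "0 \<le> l" "\<And>x. x \<ge> 0 \<Longrightarrow> f x = of_bool (l \<le> x \<and> x < h)"
  shows "integral {0..} f = max 0 (h - l)"
proof -
  have "integral {0..} f = integral {0..} (\<lambda>x. if x \<in> {l..<h} then 1 else 0)"
    by (rule Henstock_Kurzweil_Integration.integral_cong) (simp add: assms)
  also have "\<dots> = integral ({l..<h} \<inter> {0..}) (\<lambda>_. 1)"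
    by (rule Henstock_Kurzweil_Integration.integral_restrict_Int)
  also have "{l..<h} \<inter> {0..} = {l..<h}" using assms(1) by auto
  also have "integral {l..<h} (\<lambda>_. 1 :: real) = integral {l..h} (\<lambda>_. 1)"
    by (rule integral_spike_set) (rule negligible_subset[of "{h}"], auto)+
  also have "\<dots> = max 0 (h - l)" by (cases "l \<le> h") auto
  finally show ?thesis .
qed

text \<open>No monotonicity of \<open>total_corr\<close> is assumed, so the filtration may fail to consist of simplicial
complexes; the formula is nevertheless continuous in the three correlations.\<close>

lemma euler_int_eq:
  fixes q d \<rho>
  defines "a \<equiv> total_corr q d \<rho> {PA, PR}" and "b \<equiv> total_corr q d \<rho> {PB, PR}"
    and "c \<equiv> total_corr q d \<rho> {PA, PB, PR}"
  shows "euler_int q d \<rho>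
     = max 0 (min a b) - max 0 (c - max 0 (max a b)) + max 0 (min a b - max 0 c)"
proof -
  define K where "K = filt q d \<rho>"
  define \<beta> where "\<beta> = (\<lambda>k \<epsilon>. real (betti_rel (K \<epsilon>) (K \<epsilon> \<inter> deltaAB) k))"
  define S where "S = (\<lambda>\<epsilon>. {J. PR \<in> J \<and> total_corr q d \<rho> J \<le> \<epsilon>})"
  have cone: "relative_cone (K \<epsilon>) (K \<epsilon> \<inter> deltaAB) (S \<epsilon>) {PR} {PA, PR} {PB, PR} {PA, PB, PR}"
    if "\<epsilon> \<ge> 0" for \<epsilon>
  proof
    show "K \<epsilon> - K \<epsilon> \<inter> deltaAB = S \<epsilon>"
      by (auto simp: K_def S_def filt_def deltaAB_def) (metis party.exhaust)
    show "S \<epsilon> \<subseteq> {{PR}, {PA, PR}, {PB, PR}, {PA, PB, PR}}"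
      using set_with_PR by (auto simp: S_def)
    \<comment> \<open>The total correlation of a single party is 0, so the vertex R is present for
      every nonnegative \<epsilon>.\<close>
    show "{PR} \<in> S \<epsilon>" using that by (simp add: S_def total_corr_def)
  qed auto
  have mem: "{PA, PR} \<in> S \<epsilon> \<longleftrightarrow> a \<le> \<epsilon>" "{PB, PR} \<in> S \<epsilon> \<longleftrightarrow> b \<le> \<epsilon>" "{PA, PB, PR} \<in> S \<epsilon> \<longleftrightarrow> c \<le> \<epsilon>" for \<epsilon>
    by (simp_all add: S_def a_def b_def c_def)
  \<comment> \<open>The class of R lives from 0 until the first of the edges AR and BR
    appears.\<close>
  have 0: "integral {0..} (\<beta> 0) = max 0 (min a b)"
  proof -
    have "\<beta> 0 \<epsilon> = of_bool (0 \<le> \<epsilon> \<and> \<epsilon> < min a b)" if "\<epsilon> \<ge> 0" for \<epsilon>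
      unfolding \<beta>_def relative_cone.betti_rel_0[OF cone[OF that]] mem using that by auto
    from integral_indicator_Ico[OF _ this] show ?thesis by simp
  qed
  \<comment> \<open>The relative cycle AR + BR lives from the later of its edges until ABR fills it;
    the inner \<open>max\<close> with 0 cuts off at the start of the integration.\<close>
  have 1: "integral {0..} (\<beta> 1) = max 0 (c - max 0 (max a b))"
  proof (rule integral_indicator_Ico)
    show "\<beta> 1 \<epsilon> = of_bool (max 0 (max a b) \<le> \<epsilon> \<and> \<epsilon> < c)" if "\<epsilon> \<ge> 0" for \<epsilon>
      unfolding \<beta>_def relative_cone.betti_rel_1[OF cone[OF that]] mem using that by auto
  qed simp
  have 2: "integral {0..} (\<beta> 2) = max 0 (min a b - max 0 c)"
  proof (rule integral_indicator_Ico)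
    show "\<beta> 2 \<epsilon> = of_bool (max 0 c \<le> \<epsilon> \<and> \<epsilon> < min a b)" if "\<epsilon> \<ge> 0" for \<epsilon>
      unfolding \<beta>_def relative_cone.betti_rel_2[OF cone[OF that]] mem using that by auto
  qed simp
  have 3: "integral {0..} (\<beta> k) = 0" if "k \<ge> 3" for k
  proof -
    have "integral {0..} (\<beta> k) = integral {0::real..} (\<lambda>_. 0)"
      by (rule Henstock_Kurzweil_Integration.integral_cong) (simp add: \<beta>_def relative_cone.betti_rel_ge_3[OF cone that])
    then show ?thesis by simp
  qed
  have "euler_int q d \<rho> = (\<Sum>k. (-1) ^ k * integral {0..} (\<beta> k))"
    by (simp add: euler_int_def \<beta>_def K_def)
  also have "\<dots> = (\<Sum>k<3. (-1) ^ k * integral {0..} (\<beta> k))"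
    by (rule suminf_finite) (simp_all add: 3)
  also have "\<dots> = integral {0..} (\<beta> 0) - integral {0..} (\<beta> 1) + integral {0..} (\<beta> 2)"
    by (simp add: eval_nat_numeral)
  finally show ?thesis by (simp only: 0 1 2)
qed

section \<open>Passage to the limit and the sign of the conditional mutual information\<close>

theorem theorem4:
  fixes d :: "party \<Rightarrow> nat" and \<rho> :: "complex mat"
  assumes "\<forall>v. d v > 0"
    and "density_matrix d \<rho>"
  shows "((\<lambda>q. euler_int q d \<rho>) \<longlongrightarrow> - cmi d \<rho>) (at_right 1) \<and> - cmi d \<rho> \<le> 0"
proof
  note dm = assms(2)
  let ?S = "vn_entropy d \<rho>"
  define C where "C = (\<lambda>J. (\<Sum>v\<in>J. ?S {v}) - ?S J)"
  have lim: "((\<lambda>q. total_corr q d \<rho> J) \<longlongrightarrow> C J) (at_right 1)" for J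
    unfolding total_corr_def C_def
    by (intro tendsto_diff tendsto_sum tsallis_tendsto_vn_entropy[OF dm])
  define a b c where "a = C {PA, PR}" and "b = C {PB, PR}" and "c = C {PA, PB, PR}"
  \<comment> \<open>The formula is continuous in the three correlations, so the limit is taken first
    and the inequalities are applied only to the limiting values \<open>a\<close>, \<open>b\<close>,
    \<open>c\<close>.\<close>
  have "((\<lambda>q. euler_int q d \<rho>) \<longlongrightarrow>
      max 0 (min a b) - max 0 (c - max 0 (max a b)) + max 0 (min a b - max 0 c)) (at_right 1)"
    unfolding euler_int_eq a_def b_def c_def by (intro tendsto_intros lim)
  moreover have "max 0 (min a b) - max 0 (c - max 0 (max a b)) + max 0 (min a b - max 0 c) = - cmi d \<rho>"
  proof -
    have sets: "{PA} \<union> {PR} = {PA, PR}" "{PB} \<union> {PR} = {PB, PR}"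
        "{PB} \<union> {PA, PR} = {PA, PB, PR}" "{PA} \<union> {PB, PR} = {PA, PB, PR}" by auto
    \<comment> \<open>\<open>a\<close> and \<open>b\<close> are the mutual informations of R with A
      and with B; \<open>c - a\<close> is that of B with AR, and \<open>c - b\<close> that of A with
      BR.\<close>
    have "0 \<le> a" using subadditivity[OF dm, of "{PA}" "{PR}", unfolded sets] by (simp add: a_def C_def)
    moreover have "0 \<le> b" using subadditivity[OF dm, of "{PB}" "{PR}", unfolded sets] by (simp add: b_def C_def)
    moreover have "a \<le> c"
      using subadditivity[OF dm, of "{PB}" "{PA, PR}", unfolded sets] by (simp add: a_def c_def C_def)
    moreover have "b \<le> c"
      using subadditivity[OF dm, of "{PA}" "{PB, PR}", unfolded sets] by (simp add: b_def c_def C_def)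
    moreover have "a + b - c = - cmi d \<rho>" by (simp add: a_def b_def c_def C_def cmi_def)
    \<comment> \<open>Under these inequalities the last summand vanishes and the rest is
      \<open>min a b - (c - max a b)\<close>, which equals \<open>a + b - c\<close>.\<close>
    ultimately show ?thesis by (auto simp: max_def min_def)
  qed
  ultimately show "((\<lambda>q. euler_int q d \<rho>) \<longlongrightarrow> - cmi d \<rho>) (at_right 1)" by simp
  have sets: "{PA} \<union> {PB} \<union> {PR} = {PA, PB, PR}" "{PA} \<union> {PR} = {PA, PR}" "{PB} \<union> {PR} = {PB, PR}"
    by auto
  show "- cmi d \<rho> \<le> 0"
    using strong_subadditivity[OF dm, of "{PA}" "{PB}" "{PR}", unfolded sets] by (simp add: cmi_def)
qed

end
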